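(* Let $\Sigma$ be a fan in $N_{\mathbb R}$ and let $U\subset N_\Sigma$ be an open subset. For a function $\varphi:U\to\mathbb R_{-\infty}$, the following conditions are equivalent: (i) The function $\varphi$ is psh. (ii) The function $\varphi$ is continuous and $\varphi|_{U\cap N_{\mathbb R}}$ is convex. (iii) The function $\varphi$ is strongly upper semicontinuous and $\varphi|_{U\cap N_{\mathbb R}}$ is convex. (iv) The function $\varphi|_{U\cap N_{\mathbb R}}$ is convex and for every point $x\in U\setminus N_{\mathbb R}$ we have $$\varphi(x)=\limsup_{y\in U\cap N_{\mathbb R},\ y\to x}\varphi(y).$$
   Context: $N$ is a free abelian group of finite rank $n$, $N_{\mathbb R}=N\otimes\mathbb R$, and $\mathbb R_{-\infty}=\mathbb R\cup\{-\infty\}$ is topologized so that $\exp:\mathbb R_{-\infty}\to[0,\infty)$ is a homeomorphism. A fan $\Sigma$ in $N_{\mathbb R}$ is a finite polyhedral complex of strictly convex rational polyhedral cones, with support $|\Sigma|$. The associated partial compactification (tropical toric variety) is $N_\Sigma=\coprod_{\sigma\in\Sigma}N(\sigma)$ with $N(\sigma)=N_{\mathbb R}/\langle\sigma\rangle_{\mathbb R}$ and quotient maps $\pi_\sigma:N_{\mathbb R}\to N(\sigma)$; a basis of open neighbourhoods of $p\in N(\sigma)$ is given by the sets $\coprod_{\tau\prec\sigma}\pi_\tau(\Omega+\sigma)$ (union over faces $\tau$ of $\sigma$), where $\Omega$ runs over the bounded open convex subsets of $N_{\mathbb R}$ with $p\in\pi_\sigma(\Omega)$. $N_{\mathbb R}=N(\{0\})$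 is open and dense in $N_\Sigma$. A function $\varphi$ on an open subset $V$ of $N_{\mathbb R}$ with values in $\mathbb R_{-\infty}$ is convex if $\varphi((1-t)x+ty)\le(1-t)\varphi(x)+t\varphi(y)$ for all $t\in[0,1]$ and all $x,y\in V$ whose segment $[x,y]$ is contained in $V$. A function $\varphi:U\to\mathbb R_{-\infty}$ is psh if (1) $\varphi$ is upper semicontinuous; (2) $\varphi|_{U\cap N_{\mathbb R}}$ is convex; (3) for any $p\in N_{\mathbb R}$, $v\in|\Sigma|$ with $[p,p+\infty v]:=\{p+\mu v\mid\mu\in[0,\infty]\}\subset U$ we have $\varphi(p+\infty v)\le\varphi(p)$, where $p+\infty v=\lim_{\mu\to\infty}(p+\mu v)$ in $N_\Sigma$. A subset $E\subset U$ is a null set if $E\cap N_{\mathbb R}$ is a null set for the Lebesgue measure; $\varphi$ is strongly upper semicontinuous if for every null set $E\subset U$ and every $a\in U$ one has $\varphi(a)=\limsup_{x\to a,\,x\notin E}\varphi(x)$. *)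

theory Defs
  imports "HOL-Analysis.Analysis"
begin

section \<open>Lattices and fans\<close>

text \<open>A free abelian group \<open>N\<close> of finite rank is modelled as a lattice inside a Euclidean space of
  arbitrary, possibly larger, dimension. Since a basis of \<open>N\<close> is linearly independent over the
  reals, the space \<open>N \<otimes> \<real>\<close> is \<^term>\<open>span N\<close>. The rank of \<open>N\<close> may be \<open>0\<close>.\<close>

definition lattice_basis :: "'a::euclidean_space set \<Rightarrow> 'a set \<Rightarrow> bool" where
  "lattice_basis N B \<longleftrightarrow>
     finite B \<and> independent B \<and> N = {\<Sum>b\<in>B. of_int (k b) *\<^sub>R b | k :: 'a \<Rightarrow> int. True}"

definition is_lattice :: "'a::euclidean_space set \<Rightarrow> bool" where
  "is_lattice N \<longleftrightarrow> (\<exists>B. lattice_basis N B)"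

definition strictly_convex_rational_cone :: "'a::euclidean_space set \<Rightarrow> 'a set \<Rightarrow> bool" where
  "strictly_convex_rational_cone N \<sigma> \<longleftrightarrow>
     (\<exists>S. finite S \<and> S \<subseteq> N \<and> \<sigma> = convex_cone hull S) \<and> \<sigma> \<inter> uminus ` \<sigma> = {0}"

text \<open>The relation \<^const>\<open>face_of\<close> also counts the empty set as a face, which is not a cone.\<close>

definition is_fan :: "'a::euclidean_space set \<Rightarrow> 'a set set \<Rightarrow> bool" where
  "is_fan N \<Sigma> \<longleftrightarrow>
     finite \<Sigma> \<and>
     (\<forall>\<sigma>\<in>\<Sigma>. strictly_convex_rational_cone N \<sigma>) \<and>
     (\<forall>\<sigma>\<in>\<Sigma>. \<forall>\<tau>. \<tau> face_of \<sigma> \<and> \<tau> \<noteq> {} \<longrightarrow> \<tau> \<in> \<Sigma>) \<and>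
     (\<forall>\<sigma>\<in>\<Sigma>. \<forall>\<tau>\<in>\<Sigma>. \<sigma> \<inter> \<tau> face_of \<sigma> \<and> \<sigma> \<inter> \<tau> face_of \<tau>)"

section \<open>The partial compactification\<close>

text \<open>A point of the disjoint union of the quotients \<open>N(\<sigma>)\<close> is a pair of a cone \<open>\<sigma>\<close> and a coset of
  \<^term>\<open>span \<sigma>\<close>; the first component keeps apart cones with the same span. The type of
  \<open>trop_proj \<sigma>\<close> does not depend on \<open>\<sigma>\<close>.\<close>

definition trop_proj :: "'a::euclidean_space set \<Rightarrow> 'a \<Rightarrow> 'a set \<times> 'a set" where
  "trop_proj \<sigma> x = (\<sigma>, (\<lambda>y. x + y) ` span \<sigma>)"

definition trop_points :: "'a::euclidean_space set \<Rightarrow> 'a set set \<Rightarrow> ('a set \<times> 'a set) set" where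
  "trop_points N \<Sigma> = (\<Union>\<sigma>\<in>\<Sigma>. trop_proj \<sigma> ` span N)"

text \<open>The embedding of \<^term>\<open>span N\<close> as the open stratum \<open>N({0})\<close>.\<close>

abbreviation trop_emb :: "'a::euclidean_space \<Rightarrow> 'a set \<times> 'a set" where
  "trop_emb \<equiv> trop_proj {0}"

text \<open>In the next definition \<open>\<Omega> + \<sigma>\<close> is the Minkowski sum.\<close>

definition basic_nbhd ::
  "'a::euclidean_space set set \<Rightarrow> 'a set \<Rightarrow> 'a set \<Rightarrow> ('a set \<times> 'a set) set" where
  "basic_nbhd \<Sigma> \<sigma> \<Omega> = (\<Union>\<tau>\<in>{\<tau>\<in>\<Sigma>. \<tau> face_of \<sigma>}. trop_proj \<tau> ` (\<Omega> + \<sigma>))"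

definition trop_open ::
  "'a::euclidean_space set \<Rightarrow> 'a set set \<Rightarrow> ('a set \<times> 'a set) set \<Rightarrow> bool" where
  "trop_open N \<Sigma> W \<longleftrightarrow>
     W \<subseteq> trop_points N \<Sigma> \<and>
     (\<forall>\<sigma>\<in>\<Sigma>. \<forall>p \<in> W \<inter> trop_proj \<sigma> ` span N.
        \<exists>\<Omega>. bounded \<Omega> \<and> convex \<Omega> \<and> openin (top_of_set (span N)) \<Omega> \<and>
            p \<in> trop_proj \<sigma> ` \<Omega> \<and> basic_nbhd \<Sigma> \<sigma> \<Omega> \<subseteq> W)"

definition trop_toric ::
  "'a::euclidean_space set \<Rightarrow> 'a set set \<Rightarrow> ('a set \<times> 'a set) topology" where
  "trop_toric N \<Sigma> = topology (trop_open N \<Sigma>)"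

lemma span_convex_cone:
  assumes "convex_cone (\<sigma> :: 'a::real_vector set)" and "x \<in> span \<sigma>"
  shows "\<exists>u\<in>\<sigma>. \<exists>w\<in>\<sigma>. x = u - w"
proof -
  have "subspace {u - w | u w. u \<in> \<sigma> \<and> w \<in> \<sigma>}"
  proof (rule subspaceI)
    show "0 \<in> {u - w | u w. u \<in> \<sigma> \<and> w \<in> \<sigma>}"
      using convex_cone_contains_0[OF assms(1)] by force
  next
    fix x y assume "x \<in> {u - w | u w. u \<in> \<sigma> \<and> w \<in> \<sigma>}" "y \<in> {u - w | u w. u \<in> \<sigma> \<and> w \<in> \<sigma>}"
    then obtain u w u' w' where h: "x = u - w" "y = u' - w'" "u \<in> \<sigma>" "w \<in> \<sigma>" "u' \<in> \<sigma>" "w' \<in> \<sigma>"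
      by blast
    then have "x + y = (u + u') - (w + w')" "u + u' \<in> \<sigma>" "w + w' \<in> \<sigma>"
      using convex_cone_add[OF assms(1)] by auto
    then show "x + y \<in> {u - w | u w. u \<in> \<sigma> \<and> w \<in> \<sigma>}" by blast
  next
    fix c :: real and x assume "x \<in> {u - w | u w. u \<in> \<sigma> \<and> w \<in> \<sigma>}"
    then obtain u w where h: "x = u - w" "u \<in> \<sigma>" "w \<in> \<sigma>" by blast
    have sc: "d *\<^sub>R z \<in> \<sigma>" if "d \<ge> 0" "z \<in> \<sigma>" for d z
      using that assms(1) by (simp add: convex_cone_iff)
    show "c *\<^sub>R x \<in> {u - w | u w. u \<in> \<sigma> \<and> w \<in> \<sigma>}"
    proof (cases "c \<ge> 0")
      case True
      then have "c *\<^sub>R x = c *\<^sub>R u - c *\<^sub>R w" "c *\<^sub>R u \<in> \<sigma>" "c *\<^sub>R w \<in> \<sigma>"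
        using h sc by (auto simp: algebra_simps)
      then show ?thesis by blast
    next
      case False
      then have "c *\<^sub>R x = (- c) *\<^sub>R w - (- c) *\<^sub>R u" "(- c) *\<^sub>R u \<in> \<sigma>" "(- c) *\<^sub>R w \<in> \<sigma>"
        using h sc[of "- c"] by (auto simp: algebra_simps)
      then show ?thesis by blast
    qed
  qed
  moreover have "\<sigma> \<subseteq> {u - w | u w. u \<in> \<sigma> \<and> w \<in> \<sigma>}"
  proof
    fix x assume "x \<in> \<sigma>"
    then have "x = x - 0" "0 \<in> \<sigma>" using convex_cone_contains_0[OF assms(1)] by auto
    then show "x \<in> {u - w | u w. u \<in> \<sigma> \<and> w \<in> \<sigma>}" using \<open>x \<in> \<sigma>\<close> by blast
  qed
  ultimately have "span \<sigma> \<subseteq> {u - w | u w. u \<in> \<sigma> \<and> w \<in> \<sigma>}"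
    by (simp add: span_minimal)
  then show ?thesis using assms(2) by blast
qed

lemma trop_proj_eq_iff: "trop_proj \<sigma> x = trop_proj \<tau> y \<longleftrightarrow> \<sigma> = \<tau> \<and> x - y \<in> span \<sigma>"
proof
  assume "trop_proj \<sigma> x = trop_proj \<tau> y"
  then have st: "\<sigma> = \<tau>" and eq: "(\<lambda>z. x + z) ` span \<sigma> = (\<lambda>z. y + z) ` span \<sigma>"
    by (auto simp: trop_proj_def)
  have "x + 0 \<in> (\<lambda>z. x + z) ` span \<sigma>" using span_0 by blast
  then show "\<sigma> = \<tau> \<and> x - y \<in> span \<sigma>" using eq st by auto
next
  assume a: "\<sigma> = \<tau> \<and> x - y \<in> span \<sigma>"
  have "(\<lambda>z. x + z) ` span \<sigma> = (\<lambda>z. y + z) ` span \<sigma>"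
  proof (intro equalityI subsetI)
    fix p assume "p \<in> (\<lambda>z. x + z) ` span \<sigma>"
    then obtain z where "z \<in> span \<sigma>" "p = y + ((x - y) + z)" by auto
    then show "p \<in> (\<lambda>z. y + z) ` span \<sigma>" using a span_add by blast
  next
    fix p assume "p \<in> (\<lambda>z. y + z) ` span \<sigma>"
    then obtain z where "z \<in> span \<sigma>" "p = x + (z - (x - y))" by auto
    then show "p \<in> (\<lambda>z. x + z) ` span \<sigma>" using a span_diff by blast
  qed
  then show "trop_proj \<sigma> x = trop_proj \<tau> y" using a by (simp add: trop_proj_def)
qed

lemma fan_cone:
  assumes "is_fan N \<Sigma>" "\<sigma> \<in> \<Sigma>"
  shows "convex_cone \<sigma>" and "\<sigma> \<subseteq> span N"
proof -
  obtain S where S: "S \<subseteq> N" "\<sigma> = convex_cone hull S"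
    using assms by (auto simp: is_fan_def strictly_convex_rational_cone_def)
  then show "convex_cone \<sigma>" by (simp add: convex_cone_convex_cone_hull)
  have "convex_cone (span N)"
    by (simp add: convex_cone_iff span_add span_mul span_0)
  moreover have "S \<subseteq> span N" using S(1) span_superset by blast
  ultimately show "\<sigma> \<subseteq> span N" using S(2) by (simp add: hull_minimal)
qed

lemma translate_openin_span:
  assumes "openin (top_of_set (span N)) \<Omega>" "(u::'a::euclidean_space) \<in> span N"
  shows "openin (top_of_set (span N)) ((\<lambda>x. u + x) ` \<Omega>)"
proof -
  have "(\<lambda>x. u + x) ` span N = span N"
  proof (intro equalityI subsetI)
    fix x assume "x \<in> span N"
    then have "x = u + (x - u)" "x - u \<in> span N" using assms(2) span_diff by auto
    then show "x \<in> (\<lambda>x. u + x) ` span N" by blast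
  qed (use assms(2) span_add in blast)
  moreover obtain O' where O': "open O'" "\<Omega> = span N \<inter> O'"
    using assms(1) by (auto simp: openin_open)
  moreover have "(\<lambda>x. u + x) ` (span N \<inter> O') = (\<lambda>x. u + x) ` span N \<inter> (\<lambda>x. u + x) ` O'"
    by (rule image_Int) simp
  ultimately have "(\<lambda>x. u + x) ` \<Omega> = span N \<inter> (\<lambda>x. u + x) ` O'" by simp
  then show ?thesis using open_translation[OF O'(1), of u] by (auto simp: openin_open)
qed

text \<open>The sets \<open>basic_nbhd \<Sigma> \<sigma> \<Omega>\<close> are open and hence, by definition, form neighbourhood bases.\<close>

lemma trop_open_basic_nbhd:
  assumes fan: "is_fan N \<Sigma>" and \<sigma>: "\<sigma> \<in> \<Sigma>"
    and \<Omega>: "bounded \<Omega>" "convex \<Omega>" "openin (top_of_set (span N)) \<Omega>"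
  shows "trop_open N \<Sigma> (basic_nbhd \<Sigma> \<sigma> \<Omega>)"
  unfolding trop_open_def
proof (intro conjI ballI)
  note c\<sigma> = fan_cone[OF fan \<sigma>]
  have "\<Omega> + \<sigma> \<subseteq> span N"
    using openin_imp_subset[OF \<Omega>(3)] c\<sigma>(2) span_add by (fastforce simp: set_plus_def)
  then show "basic_nbhd \<Sigma> \<sigma> \<Omega> \<subseteq> trop_points N \<Sigma>"
    by (auto simp: basic_nbhd_def trop_points_def)
  fix \<tau> p assume \<tau>: "\<tau> \<in> \<Sigma>" and p: "p \<in> basic_nbhd \<Sigma> \<sigma> \<Omega> \<inter> trop_proj \<tau> ` span N"
  then obtain \<tau>' x where "\<tau>' face_of \<sigma>" "x \<in> \<Omega> + \<sigma>" "p = trop_proj \<tau>' x" "fst p = \<tau>"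
    by (auto simp: basic_nbhd_def trop_proj_def)
  then have face: "\<tau> face_of \<sigma>" and x: "x \<in> \<Omega> + \<sigma>" and px: "p = trop_proj \<tau> x"
    by (auto simp: trop_proj_def)
  obtain \<omega> s where s: "\<omega> \<in> \<Omega>" "s \<in> \<sigma>" "x = s + \<omega>"
    using x by (auto simp: set_plus_def add.commute)
  let ?\<Omega> = "(\<lambda>y. s + y) ` \<Omega>"
  have sub: "?\<Omega> + \<tau> \<subseteq> \<Omega> + \<sigma>"
  proof
    fix z assume "z \<in> ?\<Omega> + \<tau>"
    then obtain w t where "w \<in> \<Omega>" "t \<in> \<tau>" "z = w + (s + t)"
      by (auto simp: set_plus_def algebra_simps)
    moreover have "s + t \<in> \<sigma>"
      using s(2) \<open>t \<in> \<tau>\<close> face_of_imp_subset[OF face] convex_cone_add[OF c\<sigma>(1)] by blast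
    ultimately show "z \<in> \<Omega> + \<sigma>" by (auto simp: set_plus_def)
  qed
  have "basic_nbhd \<Sigma> \<tau> ?\<Omega> \<subseteq> basic_nbhd \<Sigma> \<sigma> \<Omega>"
    unfolding basic_nbhd_def using sub face_of_trans[OF _ face] by blast
  moreover have "bounded ?\<Omega>" "convex ?\<Omega>"
    using \<Omega> by (auto simp: bounded_translation convex_translation)
  moreover have "openin (top_of_set (span N)) ?\<Omega>"
    using translate_openin_span[OF \<Omega>(3)] s(2) c\<sigma>(2) by blast
  moreover have "p \<in> trop_proj \<tau> ` ?\<Omega>" using px s by blast
  ultimately show "\<exists>\<Omega>'. bounded \<Omega>' \<and> convex \<Omega>' \<and> openin (top_of_set (span N)) \<Omega>' \<and>
      p \<in> trop_proj \<tau> ` \<Omega>' \<and> basic_nbhd \<Sigma> \<tau> \<Omega>' \<subseteq> basic_nbhd \<Sigma> \<sigma> \<Omega>"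
    by blast
qed

lemma trop_openD:
  assumes "trop_open N \<Sigma> W" "\<sigma> \<in> \<Sigma>" "p \<in> W" "p \<in> trop_proj \<sigma> ` span N"
  shows "\<exists>\<Omega>. bounded \<Omega> \<and> convex \<Omega> \<and> openin (top_of_set (span N)) \<Omega> \<and>
           p \<in> trop_proj \<sigma> ` \<Omega> \<and> basic_nbhd \<Sigma> \<sigma> \<Omega> \<subseteq> W"
  using assms by (simp add: trop_open_def)

lemma istopology_trop_open:
  assumes fan: "is_fan N \<Sigma>"
  shows "istopology (trop_open N \<Sigma>)"
  unfolding istopology_def
proof (intro conjI allI impI)
  fix W W' assume W: "trop_open N \<Sigma> W" and W': "trop_open N \<Sigma> W'"
  show "trop_open N \<Sigma> (W \<inter> W')"
    unfolding trop_open_def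
  proof (intro conjI ballI)
    show "W \<inter> W' \<subseteq> trop_points N \<Sigma>" using W by (auto simp: trop_open_def)
    fix \<sigma> p assume \<sigma>: "\<sigma> \<in> \<Sigma>" and p: "p \<in> (W \<inter> W') \<inter> trop_proj \<sigma> ` span N"
    note c\<sigma> = fan_cone[OF fan \<sigma>]
    obtain \<Omega> where \<Omega>: "bounded \<Omega>" "convex \<Omega>" "openin (top_of_set (span N)) \<Omega>"
      "p \<in> trop_proj \<sigma> ` \<Omega>" "basic_nbhd \<Sigma> \<sigma> \<Omega> \<subseteq> W"
      using trop_openD[OF W \<sigma>, of p] p by auto
    obtain \<Omega>' where \<Omega>': "bounded \<Omega>'" "convex \<Omega>'" "openin (top_of_set (span N)) \<Omega>'"
      "p \<in> trop_proj \<sigma> ` \<Omega>'" "basic_nbhd \<Sigma> \<sigma> \<Omega>' \<subseteq> W'"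
      using trop_openD[OF W' \<sigma>, of p] p by auto
    obtain a a' where a: "a \<in> \<Omega>" "p = trop_proj \<sigma> a" "a' \<in> \<Omega>'" "p = trop_proj \<sigma> a'"
      using \<Omega>(4) \<Omega>'(4) by blast
    then have "a - a' \<in> span \<sigma>" using trop_proj_eq_iff by metis
    then obtain u w where uw: "u \<in> \<sigma>" "w \<in> \<sigma>" "a - a' = u - w"
      using span_convex_cone[OF c\<sigma>(1)] by blast
    let ?A = "(\<lambda>y. w + y) ` \<Omega>" and ?A' = "(\<lambda>y. u + y) ` \<Omega>'"
    have sub: "(\<lambda>y. s + y) ` X + \<sigma> \<subseteq> X + \<sigma>" if "s \<in> \<sigma>" for s X
    proof
      fix z assume "z \<in> (\<lambda>y. s + y) ` X + \<sigma>"
      then obtain x t where "x \<in> X" "t \<in> \<sigma>" "z = x + (s + t)"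
        by (auto simp: set_plus_def algebra_simps)
      moreover have "s + t \<in> \<sigma>" using that \<open>t \<in> \<sigma>\<close> convex_cone_add[OF c\<sigma>(1)] by blast
      ultimately show "z \<in> X + \<sigma>" by (auto simp: set_plus_def)
    qed
    have eq: "w + a = u + a'" using uw(3) by (simp add: algebra_simps)
    have "w + a \<in> ?A" using a(1) by (rule imageI)
    moreover have "w + a \<in> ?A'" unfolding eq using a(3) by (rule imageI)
    moreover have "p = trop_proj \<sigma> (w + a)"
      using a(2) uw(2) by (simp add: trop_proj_eq_iff span_base span_neg)
    ultimately have "p \<in> trop_proj \<sigma> ` (?A \<inter> ?A')" by (intro image_eqI[of p _ "w + a"] IntI)
    moreover have "bounded (?A \<inter> ?A')"
      using \<Omega>(1) by (simp add: bounded_translation bounded_Int)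
    moreover have "convex (?A \<inter> ?A')"
      using \<Omega>(2) \<Omega>'(2) by (intro convex_Int) (auto simp: convex_translation)
    moreover have "openin (top_of_set (span N)) (?A \<inter> ?A')"
      by (rule openin_Int[OF translate_openin_span[OF \<Omega>(3)] translate_openin_span[OF \<Omega>'(3)]])
        (use uw c\<sigma>(2) in auto)
    moreover have "(?A \<inter> ?A') + \<sigma> \<subseteq> ?A + \<sigma>" "(?A \<inter> ?A') + \<sigma> \<subseteq> ?A' + \<sigma>"
      by (intro set_plus_mono2; simp)+
    then have "(?A \<inter> ?A') + \<sigma> \<subseteq> \<Omega> + \<sigma>" "(?A \<inter> ?A') + \<sigma> \<subseteq> \<Omega>' + \<sigma>"
      using sub[OF uw(2), of \<Omega>] sub[OF uw(1), of \<Omega>'] by (auto intro: subset_trans)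
    then have "basic_nbhd \<Sigma> \<sigma> (?A \<inter> ?A') \<subseteq> basic_nbhd \<Sigma> \<sigma> \<Omega>"
      and "basic_nbhd \<Sigma> \<sigma> (?A \<inter> ?A') \<subseteq> basic_nbhd \<Sigma> \<sigma> \<Omega>'"
      unfolding basic_nbhd_def by (intro UN_mono image_mono; simp)+
    then have "basic_nbhd \<Sigma> \<sigma> (?A \<inter> ?A') \<subseteq> W \<inter> W'"
      using \<Omega>(5) \<Omega>'(5) by (intro Int_greatest) (rule subset_trans, assumption+)+
    ultimately show "\<exists>\<Omega>. bounded \<Omega> \<and> convex \<Omega> \<and> openin (top_of_set (span N)) \<Omega> \<and>
        p \<in> trop_proj \<sigma> ` \<Omega> \<and> basic_nbhd \<Sigma> \<sigma> \<Omega> \<subseteq> W \<inter> W'"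
      by (intro exI[of _ "?A \<inter> ?A'"] conjI)
  qed
next
  fix K assume K: "\<forall>W\<in>K. trop_open N \<Sigma> W"
  show "trop_open N \<Sigma> (\<Union>K)"
    unfolding trop_open_def
  proof (intro conjI ballI)
    show "\<Union>K \<subseteq> trop_points N \<Sigma>" using K by (auto simp: trop_open_def)
    fix \<sigma> p assume \<sigma>: "\<sigma> \<in> \<Sigma>" and p: "p \<in> \<Union>K \<inter> trop_proj \<sigma> ` span N"
    then obtain W where W: "W \<in> K" "p \<in> W" "p \<in> trop_proj \<sigma> ` span N" by blast
    then obtain \<Omega> where "bounded \<Omega>" "convex \<Omega>" "openin (top_of_set (span N)) \<Omega>"
      "p \<in> trop_proj \<sigma> ` \<Omega>" "basic_nbhd \<Sigma> \<sigma> \<Omega> \<subseteq> W"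
      using trop_openD[OF K[rule_format, OF W(1)] \<sigma> W(2,3)] by auto
    then show "\<exists>\<Omega>. bounded \<Omega> \<and> convex \<Omega> \<and> openin (top_of_set (span N)) \<Omega> \<and>
        p \<in> trop_proj \<sigma> ` \<Omega> \<and> basic_nbhd \<Sigma> \<sigma> \<Omega> \<subseteq> \<Union>K"
      by (intro exI[of _ \<Omega>] conjI) (use W(1) in auto)
  qed
qed

lemma openin_trop_toric: "is_fan N \<Sigma> \<Longrightarrow> openin (trop_toric N \<Sigma>) W \<longleftrightarrow> trop_open N \<Sigma> W"
  by (simp add: trop_toric_def topology_inverse' istopology_trop_open)

section \<open>Functions with values in the reals extended by minus infinity\<close>

text \<open>The space \<open>\<real>\<^sub>-\<^sub>\<infinity>\<close> is the subspace \<^term>\<open>{..<\<infinity>::ereal}\<close>. In \<^typ>\<open>ereal\<close>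
  the product \<open>0 * -\<infinity>\<close> is \<open>0\<close>, so the inequality below is void at the endpoints \<open>t = 0, 1\<close>.\<close>

definition convex_minf :: "'a::euclidean_space set \<Rightarrow> ('a \<Rightarrow> ereal) \<Rightarrow> bool" where
  "convex_minf V f \<longleftrightarrow>
     (\<forall>x\<in>V. \<forall>y\<in>V. closed_segment x y \<subseteq> V \<longrightarrow>
        (\<forall>t\<in>{0..1}. f ((1 - t) *\<^sub>R x + t *\<^sub>R y) \<le> ereal (1 - t) * f x + ereal t * f y))"

definition upper_semicontinuous_on :: "'b topology \<Rightarrow> 'b set \<Rightarrow> ('b \<Rightarrow> ereal) \<Rightarrow> bool" where
  "upper_semicontinuous_on X U f \<longleftrightarrow>
     (\<forall>r::real. openin (subtopology X U) {x \<in> topspace X \<inter> U. f x < ereal r})"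

definition finite_part ::
  "'a::euclidean_space set \<Rightarrow> ('a set \<times> 'a set) set \<Rightarrow> 'a set" where
  "finite_part N U = {x \<in> span N. trop_emb x \<in> U}"

definition convex_on_finite_part ::
  "'a::euclidean_space set \<Rightarrow> ('a set \<times> 'a set) set \<Rightarrow> ('a set \<times> 'a set \<Rightarrow> ereal) \<Rightarrow> bool" where
  "convex_on_finite_part N U \<phi> \<longleftrightarrow> convex_minf (finite_part N U) (\<phi> \<circ> trop_emb)"

text \<open>In the third condition \<open>q\<close> is the point \<open>p + \<infinity>v\<close>, that is the limit of \<open>p + \<mu>v\<close>; a limit
  exists for every \<open>v\<close> in the support of the fan and is unique.\<close>

definition psh ::
  "'a::euclidean_space set \<Rightarrow> 'a set set \<Rightarrow> ('a set \<times> 'a set) set \<Rightarrow>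
     ('a set \<times> 'a set \<Rightarrow> ereal) \<Rightarrow> bool" where
  "psh N \<Sigma> U \<phi> \<longleftrightarrow>
     upper_semicontinuous_on (trop_toric N \<Sigma>) U \<phi> \<and>
     convex_on_finite_part N U \<phi> \<and>
     (\<forall>p \<in> span N. \<forall>v \<in> \<Union>\<Sigma>. \<forall>q.
        limitin (trop_toric N \<Sigma>) (\<lambda>\<mu>::real. trop_emb (p + \<mu> *\<^sub>R v)) q at_top \<longrightarrow>
        (\<forall>\<mu>\<ge>0. trop_emb (p + \<mu> *\<^sub>R v) \<in> U) \<and> q \<in> U \<longrightarrow>
        \<phi> q \<le> \<phi> (trop_emb p))"

text \<open>The limit superior over a neighbourhood filter that is not punctured: \<open>a\<close> itself contributes
  if it lies in \<open>S\<close>. In strong upper semicontinuity this changes nothing for lattices of positive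
  rank, because \<open>a\<close> may be added to the null set. In rank \<open>0\<close> the point is not a null set
  and its own value has to be counted.\<close>

definition limsup_within :: "'b topology \<Rightarrow> 'b \<Rightarrow> 'b set \<Rightarrow> ('b \<Rightarrow> ereal) \<Rightarrow> ereal" where
  "limsup_within X a S f = Limsup (inf (nhdsin X a) (principal S)) f"

text \<open>Lebesgue measure on \<^term>\<open>span N\<close>, normalised by the lattice. It does not depend on the chosen
  basis because a change of basis of \<open>N\<close> has determinant \<open>\<plusminus>1\<close>.\<close>

definition lattice_lebesgue :: "'a::euclidean_space set \<Rightarrow> 'a measure" where
  "lattice_lebesgue N =
     (let B = (SOME B. lattice_basis N B) in
        completion (distr (\<Pi>\<^sub>M b\<in>B. (lborel :: real measure)) (restrict_space borel (span N))
          (\<lambda>c. \<Sum>b\<in>B. c b *\<^sub>R b)))"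

definition null_subset :: "'a::euclidean_space set \<Rightarrow> ('a set \<times> 'a set) set \<Rightarrow> bool" where
  "null_subset N E \<longleftrightarrow> finite_part N E \<in> null_sets (lattice_lebesgue N)"

definition strongly_usc ::
  "'a::euclidean_space set \<Rightarrow> 'a set set \<Rightarrow> ('a set \<times> 'a set) set \<Rightarrow>
     ('a set \<times> 'a set \<Rightarrow> ereal) \<Rightarrow> bool" where
  "strongly_usc N \<Sigma> U \<phi> \<longleftrightarrow>
     (\<forall>E. E \<subseteq> U \<and> null_subset N E \<longrightarrow>
        (\<forall>a\<in>U. \<phi> a = limsup_within (trop_toric N \<Sigma>) a (U - E) \<phi>))"

end

theory Submission
  imports Defs
begin

text \<open>The four conditions are linked in a cycle: psh, continuous, strongly upper semicontinuous,
  determined at infinity by upper limits, psh; convexity on the finite part is common to all.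

  Convexity controls \<open>\<phi>\<close> in two ways. On an open subset of \<open>N\<^sub>\<real>\<close> a convex function with values
  \<open><\<infinity>\<close> is continuous (\<open>epi_convex_continuous_on\<close>), and along a ray on which it stays bounded above it
  never increases (\<open>epi_convex_ray_nonincreasing\<close>). A point of \<open>N(\<sigma>)\<close> has neighbourhoods whose finite
  part is \<open>\<Omega> + \<sigma>\<close> with \<open>\<Omega>\<close> a small ball, and such sets are full of rays in directions of \<open>\<sigma>\<close>.

  A psh function is continuous (\<open>psh_imp_continuous_at\<close>): at \<open>\<pi>\<^sub>\<sigma> x\<close> it is the limit of its values along
  \<open>x + \<mu> v\<close> with \<open>v\<close> interior to \<open>\<sigma>\<close>. Therefore its restriction to the stratum is convex and
  continuous, and it bounds \<open>\<phi>\<close> from below on all nearby strata.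
  A continuous function agrees with its upper limit along any set that accumulates at the point, and
  the complement of a null set does so everywhere because nonempty open sets have positive measure
  (\<open>lattice_lebesgue_nonempty_open\<close>). The boundary is a null set, so strong
  semicontinuity yields the upper limit over the finite part. Finally, if boundary
  values are such upper limits, \<open>\<phi>\<close> is bounded above on \<open>\<Omega> + \<sigma>\<close>, hence nonincreasing along
  \<open>\<sigma>\<close> there, and a bound at one point of a ray spreads to a neighbourhood of its end point
  (\<open>limsup_finite_part_imp_psh\<close>).\<close>

section \<open>Convex functions with values in the extended reals\<close>

text \<open>Convexity of an extended real valued function, expressed through its strict epigraph: only real
  upper bounds of the values occur, so no product or sum with \<open>-\<infinity>\<close> has to be evaluated and the
  condition survives pointwise limits.\<close>

definition epi_convex :: "'a::real_vector set \<Rightarrow> ('a \<Rightarrow> ereal) \<Rightarrow> bool" where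
  "epi_convex V f \<longleftrightarrow>
     (\<forall>x y t a b. x \<in> V \<and> y \<in> V \<and> closed_segment x y \<subseteq> V \<and> t \<in> {0..1} \<and> f x < ereal a \<and> f y < ereal b
        \<longrightarrow> f ((1 - t) *\<^sub>R x + t *\<^sub>R y) \<le> ereal ((1 - t) * a + t * b))"

lemma epi_convexD:
  assumes "epi_convex V f" "x \<in> V" "y \<in> V" "closed_segment x y \<subseteq> V" "0 \<le> t" "t \<le> 1"
    "f x < ereal a" "f y < ereal b"
  shows "f ((1 - t) *\<^sub>R x + t *\<^sub>R y) \<le> ereal ((1 - t) * a + t * b)"
  using assms unfolding epi_convex_def by auto

lemma convex_minf_imp_epi_convex:
  assumes "convex_minf V f"
  shows "epi_convex V f"
  unfolding epi_convex_def
proof (intro allI impI, elim conjE)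
  fix x y and t a b :: real
  assume h: "x \<in> V" "y \<in> V" "closed_segment x y \<subseteq> V" "t \<in> {0..1}" "f x < ereal a" "f y < ereal b"
  have "f ((1 - t) *\<^sub>R x + t *\<^sub>R y) \<le> ereal (1 - t) * f x + ereal t * f y"
    using assms h(1-4) by (auto simp: convex_minf_def)
  also have "\<dots> \<le> ereal (1 - t) * ereal a + ereal t * ereal b"
    using h by (intro add_mono ereal_mult_left_mono) auto
  finally show "f ((1 - t) *\<^sub>R x + t *\<^sub>R y) \<le> ereal ((1 - t) * a + t * b)" by simp
qed

lemma epi_convex_subset: "epi_convex V f \<Longrightarrow> W \<subseteq> V \<Longrightarrow> epi_convex W f"
  unfolding epi_convex_def by blast

lemma epi_convex_cong:
  assumes "epi_convex V f" and eq: "\<And>x. x \<in> V \<Longrightarrow> g x = f x"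
  shows "epi_convex V g"
  unfolding epi_convex_def
proof (intro allI impI, elim conjE)
  fix x y and t a b :: real
  assume h: "x \<in> V" "y \<in> V" "closed_segment x y \<subseteq> V" "t \<in> {0..1}" "g x < ereal a" "g y < ereal b"
  then have "(1 - t) *\<^sub>R x + t *\<^sub>R y \<in> V" by (auto simp: closed_segment_def)
  then show "g ((1 - t) *\<^sub>R x + t *\<^sub>R y) \<le> ereal ((1 - t) * a + t * b)"
    using h epi_convexD[OF assms(1), of x y t a b] by (simp add: eq)
qed

text \<open>On the segment from \<open>x1\<close> through \<open>x\<close> to a point beyond \<open>x\<close>, the value \<open>-\<infinity>\<close> at \<open>x1\<close> and any
  finite bound at the far end force arbitrarily small values in between. Hence on a convex
  relatively open set a convex function is either \<open>-\<infinity>\<close> everywhere or finite everywhere.\<close>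

lemma epi_convex_infinite_spreads:
  assumes conv: "epi_convex V f" and V: "convex V" and x1: "x1 \<in> V" "f x1 = -\<infinity>"
    and x: "x \<in> V" and d: "d > 0" "x + d *\<^sub>R (x - x1) \<in> V" and fin: "f (x + d *\<^sub>R (x - x1)) < \<infinity>"
  shows "f x = -\<infinity>"
proof -
  define x2 where "x2 = x + d *\<^sub>R (x - x1)"
  obtain b where b: "f x2 < ereal b"
    using fin less_PInf_Ex_of_nat unfolding x2_def by (metis ereal_dense2)
  \<comment> \<open>the weight for which \<open>x = (1 - t) x1 + t x2\<close>\<close>
  define t where "t = 1 / (1 + d)"
  have t: "0 < t" "t < 1" using d(1) by (auto simp: t_def)
  have td: "t + t * d = 1" using d(1) by (simp add: t_def field_simps)
  have "(1 - t) *\<^sub>R x1 + t *\<^sub>R x2 = (1 - (t + t * d)) *\<^sub>R x1 + (t + t * d) *\<^sub>R x"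
    by (simp add: x2_def algebra_simps)
  then have xe: "(1 - t) *\<^sub>R x1 + t *\<^sub>R x2 = x" using td by simp
  have seg: "closed_segment x1 x2 \<subseteq> V"
    using V x1(1) d(2) by (simp add: x2_def closed_segment_subset)
  have "f x \<le> ereal c" for c
  proof -
    \<comment> \<open>since \<open>f x1 = -\<infinity>\<close>, the bound at \<open>x1\<close> can be chosen so that the combination is \<open>c\<close>\<close>
    have "f ((1 - t) *\<^sub>R x1 + t *\<^sub>R x2) \<le> ereal ((1 - t) * ((c - t * b) / (1 - t)) + t * b)"
      by (rule epi_convexD[OF conv]) (use x1 d(2) b t seg in \<open>auto simp: x2_def\<close>)
    then show ?thesis using t by (simp add: xe)
  qed
  then show ?thesis by (metis ereal_bot)
qed

lemma projection_onto_subspace: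
  fixes S :: "'a::euclidean_space set"
  assumes "subspace S"
  obtains P where "linear P" "range P \<subseteq> S" "\<And>x. x \<in> S \<Longrightarrow> P x = x"
  using linear_exists_left_inverse_on[OF linear_id assms] by auto

text \<open>Convex functions are continuous on open sets of a Euclidean space. For a set that is open only
  relative to a subspace, compose with a linear projection onto the subspace: the composition is
  convex on an open set and restricts to the given function.\<close>

lemma epi_convex_continuous_real:
  fixes S :: "'a::euclidean_space set" and g :: "'a \<Rightarrow> real"
  assumes S: "subspace S" and C: "openin (top_of_set S) C" "convex C"
    and conv: "epi_convex C (\<lambda>x. ereal (g x))"
  shows "continuous_on C g"
proof -
  obtain P where P: "linear P" "range P \<subseteq> S" "\<And>x. x \<in> S \<Longrightarrow> P x = x"
    using projection_onto_subspace[OF S] by blast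
  obtain G where G: "open G" "C = S \<inter> G" using C(1) by (auto simp: openin_open)
  have eq: "P -` C = P -` G" using G P(2) by auto
  have gC: "convex_on C g"
  proof (rule convex_onI[OF _ C(2)])
    fix t :: real and x y assume h: "0 < t" "t < 1" "x \<in> C" "y \<in> C"
    show "g ((1 - t) *\<^sub>R x + t *\<^sub>R y) \<le> (1 - t) * g x + t * g y"
    proof (rule field_le_epsilon)
      fix e :: real assume "e > 0"
      then have "ereal (g ((1 - t) *\<^sub>R x + t *\<^sub>R y)) \<le> ereal ((1 - t) * (g x + e) + t * (g y + e))"
        using h C(2) by (intro epi_convexD[OF conv]) (auto simp: closed_segment_subset)
      then show "g ((1 - t) *\<^sub>R x + t *\<^sub>R y) \<le> (1 - t) * g x + t * g y + e"
        by (simp add: algebra_simps)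
    qed
  qed
  have "convex_on (P -` C) (g \<circ> P)"
  proof (rule convex_onI)
    show "convex (P -` C)" using P(1) C(2) by (rule convex_linear_vimage)
    fix t :: real and x y assume h: "0 < t" "t < 1" "x \<in> P -` C" "y \<in> P -` C"
    then show "(g \<circ> P) ((1 - t) *\<^sub>R x + t *\<^sub>R y) \<le> (1 - t) * (g \<circ> P) x + t * (g \<circ> P) y"
      using convex_onD[OF gC, of t "P x" "P y"] P(1) by (simp add: linear_add linear_scale)
  qed
  moreover have "open (P -` C)"
    unfolding eq using P(1) G(1) by (simp add: linear_continuous_on linear_linear open_vimage)
  ultimately have "continuous_on (P -` C) (g \<circ> P)" by (rule convex_on_continuous[rotated])
  moreover have "C \<subseteq> P -` C" using G P(3) by auto
  ultimately have "continuous_on C (g \<circ> P)" by (rule continuous_on_subset)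
  moreover have "(g \<circ> P) x = g x" if "x \<in> C" for x using that G P(3) by auto
  ultimately show ?thesis using continuous_on_cong by metis
qed

text \<open>Continuity is local, so \<open>V\<close> may be replaced by a small convex piece of a ball. There the function is
  either constantly \<open>-\<infinity>\<close> or real valued.\<close>

lemma epi_convex_continuous_on:
  fixes S :: "'a::euclidean_space set" and f :: "'a \<Rightarrow> ereal"
  assumes S: "subspace S" and V: "openin (top_of_set S) V"
    and conv: "epi_convex V f" and fin: "\<And>x. x \<in> V \<Longrightarrow> f x < \<infinity>"
  shows "continuous_on V f"
proof -
  have "(f \<longlongrightarrow> f x0) (at x0 within V)" if x0: "x0 \<in> V" for x0
  proof -
    obtain e where e: "e > 0" "ball x0 e \<inter> S \<subseteq> V"
      using V x0 by (auto simp: openin_contains_ball)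
    define C where "C = S \<inter> ball x0 e"
    have CS: "openin (top_of_set S) C" by (auto simp: C_def)
    have C: "convex C" using S by (auto simp: C_def subspace_imp_convex convex_Int)
    have CV: "C \<subseteq> V" using e by (auto simp: C_def)
    have x0C: "x0 \<in> C" using x0 e(1) openin_imp_subset[OF V] by (auto simp: C_def)
    have convC: "epi_convex C f" using epi_convex_subset[OF conv CV] .
    have "continuous_on C f"
    proof (cases "\<exists>x1\<in>C. f x1 = -\<infinity>")
      case True
      then obtain x1 where x1: "x1 \<in> C" "f x1 = -\<infinity>" by blast
      have "f x = -\<infinity>" if x: "x \<in> C" for x
      proof -
        obtain r where r: "r > 0" "ball x r \<inter> S \<subseteq> C"
          using CS x by (auto simp: openin_contains_ball)
        \<comment> \<open>a step beyond \<open>x\<close> that stays in the ball of radius \<open>r\<close>; the summand 1 covers \<open>x = x1\<close>\<close>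
        define d where "d = r / (2 * (norm (x - x1) + 1))"
        have d: "d > 0" using r(1) by (simp add: d_def add_nonneg_pos)
        have "d * (2 * (norm (x - x1) + 1)) = r"
          using norm_ge_zero[of "x - x1"] unfolding d_def by (simp add: add_nonneg_eq_0_iff)
        then have "2 * (d * norm (x - x1)) + 2 * d = r" by (simp add: algebra_simps)
        then have "d * norm (x - x1) < r"
          using d mult_nonneg_nonneg[OF less_imp_le[OF d] norm_ge_zero, of "x - x1"] by linarith
        then have "norm (d *\<^sub>R (x - x1)) < r" using d by simp
        moreover have "x + d *\<^sub>R (x - x1) \<in> S"
          using x x1(1) S by (auto simp: C_def intro!: subspace_add subspace_mul subspace_diff)
        ultimately have "x + d *\<^sub>R (x - x1) \<in> C" using r(2) by (auto simp: dist_norm)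
        then show ?thesis
          using epi_convex_infinite_spreads[OF convC C x1 x d] fin CV by blast
      qed
      then show ?thesis using continuous_on_cong[of C C f "\<lambda>_. -\<infinity>"] by auto
    next
      case False
      then have eq: "ereal (real_of_ereal (f x)) = f x" if "x \<in> C" for x
        using that False fin[of x] CV by (cases "f x") auto
      then have "epi_convex C (\<lambda>x. ereal (real_of_ereal (f x)))"
        using epi_convex_cong[OF convC] by simp
      then have "continuous_on C (\<lambda>x. real_of_ereal (f x))"
        by (rule epi_convex_continuous_real[OF S CS C])
      then have "continuous_on C (\<lambda>x. ereal (real_of_ereal (f x)))"
        by (rule continuous_on_ereal)
      then show ?thesis using eq continuous_on_cong by fastforce
    qed
    moreover have "at x0 within V = at x0 within C"
      using e openin_imp_subset[OF V] by (intro at_within_nhd[of _ "ball x0 e"]) (auto simp: C_def)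
    ultimately show ?thesis using x0C by (simp add: continuous_on_def)
  qed
  then show ?thesis by (simp add: continuous_on_def)
qed

text \<open>A convex function of one variable that is bounded above near \<open>+\<infinity>\<close> has no increasing step: its
  value at \<open>\<mu>\<close> lies below the chord from \<open>0\<close> to a far point \<open>t\<close>, and the height of that chord at \<open>\<mu>\<close>
  tends to the value at \<open>0\<close>.\<close>

lemma epi_convex_ray_nonincreasing:
  assumes conv: "epi_convex V f"
    and ray: "\<And>\<mu>. \<mu> \<ge> 0 \<Longrightarrow> y + \<mu> *\<^sub>R s \<in> V"
    and bound: "eventually (\<lambda>\<mu>. f (y + \<mu> *\<^sub>R s) < ereal M) at_top" and "\<mu> \<ge> 0"
  shows "f (y + \<mu> *\<^sub>R s) \<le> f y"
proof (rule ereal_le_real)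
  fix a assume a: "f y \<le> ereal a"
  have "f (y + \<mu> *\<^sub>R s) \<le> ereal (a + e)" if e: "e > 0" for e
  proof -
    have ev: "eventually (\<lambda>t. f (y + \<mu> *\<^sub>R s) \<le> ereal ((1 - \<mu> / t) * (a + e) + \<mu> / t * M)) at_top"
      using bound eventually_gt_at_top[of \<mu>] eventually_gt_at_top[of 0]
    proof eventually_elim
      case (elim t)
      have in_seg: "closed_segment y (y + t *\<^sub>R s) \<subseteq> V"
      proof
        fix z assume "z \<in> closed_segment y (y + t *\<^sub>R s)"
        then obtain u where "0 \<le> u" "z = y + (u * t) *\<^sub>R s"
          by (auto simp: in_segment algebra_simps)
        then show "z \<in> V" using ray[of "u * t"] elim by simp
      qed
      have "f ((1 - \<mu> / t) *\<^sub>R y + (\<mu> / t) *\<^sub>R (y + t *\<^sub>R s)) \<le> ereal ((1 - \<mu> / t) * (a + e) + \<mu> / t * M)"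
        using ray[of 0] ray[of t] elim in_seg \<open>\<mu> \<ge> 0\<close> a e
        by (intro epi_convexD[OF conv]) (auto intro: le_less_trans)
      moreover have "(1 - \<mu> / t) *\<^sub>R y + (\<mu> / t) *\<^sub>R (y + t *\<^sub>R s) = y + \<mu> *\<^sub>R s"
        using elim by (simp add: algebra_simps)
      ultimately show ?case by simp
    qed
    have "((\<lambda>t. (1 - \<mu> / t) * (a + e) + \<mu> / t * M) \<longlongrightarrow> (1 - 0) * (a + e) + 0 * M) at_top"
      by (intro tendsto_intros tendsto_divide_0[OF tendsto_const] filterlim_at_top_imp_at_infinity filterlim_ident)
    then have "((\<lambda>t. ereal ((1 - \<mu> / t) * (a + e) + \<mu> / t * M)) \<longlongrightarrow> ereal (a + e)) at_top"
      by simp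
    then show ?thesis by (rule tendsto_lowerbound[OF _ ev]) simp
  qed
  then show "f (y + \<mu> *\<^sub>R s) \<le> ereal a"
    by (metis ereal_le_epsilon2 plus_ereal.simps(1))
qed

section \<open>Neighbourhoods in the partial compactification\<close>

lemma openin_obtain_ball:
  assumes "openin (top_of_set S) A" "x \<in> A"
  obtains d where "d > 0" "ball x d \<inter> S \<subseteq> A"
  using assms unfolding openin_contains_ball by blast

text \<open>Strict convexity of the cones makes the origin a vertex of each of them. Hence a fan with a cone
  has the open stratum \<open>N({0})\<close>, and this stratum meets every neighbourhood of every point.\<close>

lemma fan_zero_face:
  assumes fan: "is_fan N \<Sigma>" and \<sigma>: "\<sigma> \<in> \<Sigma>"
  shows "{0} \<in> \<Sigma>" "{0} face_of \<sigma>"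
proof -
  note c = fan_cone[OF fan \<sigma>]
  have pt: "\<sigma> \<inter> uminus ` \<sigma> = {0}"
    using fan \<sigma> by (auto simp: is_fan_def strictly_convex_rational_cone_def)
  have "a = 0 \<and> b = 0" if ab: "a \<in> \<sigma>" "b \<in> \<sigma>" "0 \<in> open_segment a b" for a b
  proof -
    obtain t where t: "0 < t" "t < 1" "(1 - t) *\<^sub>R a + t *\<^sub>R b = 0"
      using ab(3) by (auto simp: in_segment)
    have "(1 - t) *\<^sub>R a \<in> \<sigma>" "t *\<^sub>R b \<in> \<sigma>" "(1 - t) *\<^sub>R a = - (t *\<^sub>R b)"
      using t ab(1,2) c(1) by (simp_all add: convex_cone_iff eq_neg_iff_add_eq_0)
    then have "(1 - t) *\<^sub>R a = 0" using pt by (metis IntI imageI singletonD)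
    then show ?thesis using t by auto
  qed
  moreover have "0 \<in> \<sigma>" using c(1) convex_cone_contains_0 by blast
  ultimately show "{0} face_of \<sigma>"
    by (auto simp: face_of_singleton extreme_point_of_def open_segment_def)
  then show "{0} \<in> \<Sigma>" using fan \<sigma> unfolding is_fan_def by blast
qed

lemma fan_face_of_refl:
  assumes "is_fan N \<Sigma>" "\<sigma> \<in> \<Sigma>"
  shows "\<sigma> face_of \<sigma>"
  using fan_cone(1)[OF assms] by (simp add: face_of_refl convex_cone_def)

lemma mem_ball_Int_span_plus:
  "x \<in> (ball p e \<inter> span N) + \<sigma> \<longleftrightarrow> (\<exists>w s. w \<in> span N \<and> dist p w < e \<and> s \<in> \<sigma> \<and> x = w + s)"
  by (auto simp: set_plus_def)

lemma openin_basic_nbhd_ball: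
  assumes fan: "is_fan N \<Sigma>" and \<sigma>: "\<sigma> \<in> \<Sigma>"
  shows "openin (trop_toric N \<Sigma>) (basic_nbhd \<Sigma> \<sigma> (ball p e \<inter> span N))"
  unfolding openin_trop_toric[OF fan]
proof (rule trop_open_basic_nbhd[OF fan \<sigma>])
  show "bounded (ball p e \<inter> span N)" by (simp add: bounded_Int)
  show "convex (ball p e \<inter> span N)" by (simp add: convex_Int subspace_imp_convex)
  show "openin (top_of_set (span N)) (ball p e \<inter> span N)"
    using openin_open_Int[of "ball p e" "span N"] by (simp add: Int_commute)
qed

lemma trop_proj_in_basic_nbhd_ball:
  assumes fan: "is_fan N \<Sigma>" and \<sigma>: "\<sigma> \<in> \<Sigma>" and p: "p \<in> span N" "e > 0"
  shows "trop_proj \<sigma> p \<in> basic_nbhd \<Sigma> \<sigma> (ball p e \<inter> span N)"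
proof -
  have "0 \<in> \<sigma>" using fan_cone(1)[OF fan \<sigma>] convex_cone_contains_0 by blast
  then have "p \<in> ball p e \<inter> span N + \<sigma>"
    using p set_plus_intro[of p "ball p e \<inter> span N" 0 \<sigma>] by simp
  then show ?thesis using \<sigma> fan_face_of_refl[OF fan \<sigma>] unfolding basic_nbhd_def by blast
qed

lemma eventually_nhdsin_trop_toricI:
  assumes fan: "is_fan N \<Sigma>" and \<sigma>: "\<sigma> \<in> \<Sigma>" and p: "p \<in> span N" and e: "e > 0"
    and P: "\<And>\<tau> x. \<tau> \<in> \<Sigma> \<Longrightarrow> \<tau> face_of \<sigma> \<Longrightarrow> x \<in> ball p e \<inter> span N + \<sigma> \<Longrightarrow> P (trop_proj \<tau> x)"
  shows "eventually P (nhdsin (trop_toric N \<Sigma>) (trop_proj \<sigma> p))"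
proof -
  let ?W = "basic_nbhd \<Sigma> \<sigma> (ball p e \<inter> span N)"
  have "\<forall>x\<in>?W. P x" using P by (auto simp: basic_nbhd_def)
  then show ?thesis
    using openin_basic_nbhd_ball[OF fan \<sigma>] trop_proj_in_basic_nbhd_ball[OF fan \<sigma> p e]
    unfolding eventually_nhdsin by blast
qed

text \<open>The representative of a point of \<open>N(\<sigma>)\<close> has to be chosen together with the neighbourhood: the
  sets \<open>ball p e + \<sigma>\<close> shrink as \<open>p\<close> moves into the direction of \<open>\<sigma>\<close>, although the coset of \<open>p\<close> does
  not change.\<close>

lemma eventually_nhdsin_trop_toricE:
  assumes fan: "is_fan N \<Sigma>" and \<sigma>: "\<sigma> \<in> \<Sigma>" and p: "p \<in> span N"
    and ev: "eventually P (nhdsin (trop_toric N \<Sigma>) (trop_proj \<sigma> p))"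
  obtains p' e where "p' \<in> span N" "trop_proj \<sigma> p = trop_proj \<sigma> p'" "e > 0"
    "\<And>\<tau> x. \<tau> \<in> \<Sigma> \<Longrightarrow> \<tau> face_of \<sigma> \<Longrightarrow> x \<in> ball p' e \<inter> span N + \<sigma> \<Longrightarrow> P (trop_proj \<tau> x)"
proof -
  have "trop_proj \<sigma> p \<in> topspace (trop_toric N \<Sigma>)"
    using openin_subset[OF openin_basic_nbhd_ball[OF fan \<sigma>]]
      trop_proj_in_basic_nbhd_ball[OF fan \<sigma> p zero_less_one] by blast
  then obtain W where W: "trop_open N \<Sigma> W" "trop_proj \<sigma> p \<in> W" "\<forall>x\<in>W. P x"
    using ev by (auto simp: eventually_nhdsin openin_trop_toric[OF fan])
  obtain \<Omega> where \<Omega>: "openin (top_of_set (span N)) \<Omega>" "trop_proj \<sigma> p \<in> trop_proj \<sigma> ` \<Omega>"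
    "basic_nbhd \<Sigma> \<sigma> \<Omega> \<subseteq> W"
    using trop_openD[OF W(1) \<sigma> W(2)] p by auto
  obtain p' where p': "p' \<in> \<Omega>" "trop_proj \<sigma> p = trop_proj \<sigma> p'" using \<Omega>(2) by auto
  obtain e where e: "e > 0" "ball p' e \<inter> span N \<subseteq> \<Omega>"
    using \<Omega>(1) p'(1) by (auto simp: openin_contains_ball)
  show thesis
  proof (rule that[OF _ p'(2) e(1)])
    show "p' \<in> span N" using \<Omega>(1) p'(1) openin_imp_subset by blast
    fix \<tau> x assume h: "\<tau> \<in> \<Sigma>" "\<tau> face_of \<sigma>" "x \<in> ball p' e \<inter> span N + \<sigma>"
    then have "x \<in> \<Omega> + \<sigma>" using e(2) set_plus_mono2[OF e(2) subset_refl[of \<sigma>]] by blast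
    then show "P (trop_proj \<tau> x)" using h W(3) \<Omega>(3) unfolding basic_nbhd_def by blast
  qed
qed

lemma trop_point_cases:
  assumes "is_fan N \<Sigma>" "openin (trop_toric N \<Sigma>) U" "a \<in> U"
  obtains \<sigma> p where "\<sigma> \<in> \<Sigma>" "p \<in> span N" "a = trop_proj \<sigma> p"
  using assms by (auto simp: openin_trop_toric trop_open_def trop_points_def)

lemma openin_imp_eventually_nhdsin: "openin X U \<Longrightarrow> a \<in> U \<Longrightarrow> eventually (\<lambda>x. x \<in> U) (nhdsin X a)"
  by (auto simp: eventually_nhdsin)

lemma limitin_iff_filterlim_nhdsin:
  "limitin X f l F \<longleftrightarrow> l \<in> topspace X \<and> filterlim f (nhdsin X l) F"
proof
  assume h: "limitin X f l F"
  have "eventually (\<lambda>x. P (f x)) F" if P: "eventually P (nhdsin X l)" for P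
  proof -
    obtain W where "openin X W" "l \<in> W" and W: "\<forall>x\<in>W. P x"
      using P h by (auto simp: eventually_nhdsin limitin_def)
    then have "eventually (\<lambda>x. f x \<in> W) F" using h by (simp add: limitin_def)
    then show ?thesis by (rule eventually_mono) (use W in blast)
  qed
  then show "l \<in> topspace X \<and> filterlim f (nhdsin X l) F"
    using h by (auto simp: limitin_def filterlim_iff)
next
  assume h: "l \<in> topspace X \<and> filterlim f (nhdsin X l) F"
  show "limitin X f l F"
    unfolding limitin_def using h openin_imp_eventually_nhdsin[of X _ l] by (auto simp: filterlim_iff)
qed

lemma openin_finite_part:
  assumes fan: "is_fan N \<Sigma>" and U: "openin (trop_toric N \<Sigma>) U"
  shows "openin (top_of_set (span N)) (finite_part N U)"
  unfolding openin_contains_ball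
proof (intro conjI ballI)
  show "finite_part N U \<subseteq> span N" by (auto simp: finite_part_def)
  fix x assume x: "x \<in> finite_part N U"
  then have x': "x \<in> span N" "trop_emb x \<in> U" by (auto simp: finite_part_def)
  obtain \<sigma> q where "\<sigma> \<in> \<Sigma>" "trop_emb x = trop_proj \<sigma> q" using trop_point_cases[OF fan U x'(2)] .
  then have z: "{0} \<in> \<Sigma>" by (auto simp: trop_proj_def)
  obtain p' e where p': "trop_emb x = trop_emb p'" "e > 0"
    "\<And>\<tau> y. \<tau> \<in> \<Sigma> \<Longrightarrow> \<tau> face_of {0} \<Longrightarrow> y \<in> ball p' e \<inter> span N + {0} \<Longrightarrow> trop_proj \<tau> y \<in> U"
    using eventually_nhdsin_trop_toricE[OF fan z x'(1) openin_imp_eventually_nhdsin[OF U x'(2)]] by metis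
  have "p' = x" using p'(1) by (simp add: trop_proj_eq_iff)
  have "ball x e \<inter> span N \<subseteq> finite_part N U"
  proof
    fix y assume y: "y \<in> ball x e \<inter> span N"
    then have "y \<in> ball p' e \<inter> span N + {0}"
      using \<open>p' = x\<close> set_plus_intro[of y "ball x e \<inter> span N" 0 "{0}"] by simp
    then show "y \<in> finite_part N U"
      using y p'(3)[OF z fan_face_of_refl[OF fan z]] by (simp add: finite_part_def)
  qed
  then show "\<exists>e>0. ball x e \<inter> span N \<subseteq> finite_part N U" using p'(2) by blast
qed

section \<open>Limits of rays\<close>

text \<open>A direction in the relative interior of \<open>\<tau>\<close> absorbs every displacement in the span of \<open>\<tau>\<close>: from
  any representative of the coset, far along the ray, one is in the translate of \<open>\<tau>\<close> at any other
  representative.\<close>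

lemma ray_tends_to_projection:
  assumes fan: "is_fan N \<Sigma>" and \<tau>: "\<tau> \<in> \<Sigma>" and y: "y \<in> span N" and v: "v \<in> rel_interior \<tau>"
  shows "filterlim (\<lambda>\<mu>. trop_emb (y + \<mu> *\<^sub>R v)) (nhdsin (trop_toric N \<Sigma>) (trop_proj \<tau> y)) at_top"
  unfolding filterlim_iff
proof (intro allI impI)
  fix P assume "eventually P (nhdsin (trop_toric N \<Sigma>) (trop_proj \<tau> y))"
  then obtain p e where p: "p \<in> span N" "trop_proj \<tau> y = trop_proj \<tau> p" "e > 0"
    "\<And>\<tau>' x. \<tau>' \<in> \<Sigma> \<Longrightarrow> \<tau>' face_of \<tau> \<Longrightarrow> x \<in> ball p e \<inter> span N + \<tau> \<Longrightarrow> P (trop_proj \<tau>' x)"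
    using eventually_nhdsin_trop_toricE[OF fan \<tau> y] by metis
  note c = fan_cone[OF fan \<tau>]
  have aff: "affine hull \<tau> = span \<tau>"
    using convex_cone_contains_0[OF c(1)] by (simp add: affine_hull_span_0 hull_inc)
  obtain d where d: "d > 0" "ball v d \<inter> span \<tau> \<subseteq> \<tau>" "v \<in> \<tau>"
    using v aff by (auto simp: mem_rel_interior_ball)
  \<comment> \<open>rescaled by \<open>1 / \<mu>\<close>, the position relative to \<open>p\<close> tends to \<open>v\<close>\<close>
  have "((\<lambda>\<mu>. v + inverse \<mu> *\<^sub>R (y - p)) \<longlongrightarrow> v + 0 *\<^sub>R (y - p)) at_top"
    by (intro tendsto_intros tendsto_inverse_0_at_top filterlim_ident)
  then have "((\<lambda>\<mu>. v + inverse \<mu> *\<^sub>R (y - p)) \<longlongrightarrow> v) at_top" by simp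
  then have "eventually (\<lambda>\<mu>. dist (v + inverse \<mu> *\<^sub>R (y - p)) v < d) at_top"
    using d(1) by (rule tendstoD)
  then show "eventually (\<lambda>\<mu>. P (trop_emb (y + \<mu> *\<^sub>R v))) at_top"
    using eventually_gt_at_top[of 0]
  proof eventually_elim
    case (elim \<mu>)
    have "y - p \<in> span \<tau>" using p(2) by (simp add: trop_proj_eq_iff)
    then have "v + inverse \<mu> *\<^sub>R (y - p) \<in> span \<tau>"
      using d(3) by (simp add: span_add span_base span_mul)
    then have "v + inverse \<mu> *\<^sub>R (y - p) \<in> \<tau>" using elim d(2) by (auto simp: dist_commute)
    then have "\<mu> *\<^sub>R (v + inverse \<mu> *\<^sub>R (y - p)) \<in> \<tau>"
      using c(1) elim by (simp add: convex_cone_iff)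
    moreover have "y + \<mu> *\<^sub>R v = p + \<mu> *\<^sub>R (v + inverse \<mu> *\<^sub>R (y - p))"
      using elim by (simp add: algebra_simps)
    ultimately have "y + \<mu> *\<^sub>R v \<in> ball p e \<inter> span N + \<tau>"
      using p(1,3) by (auto simp: mem_ball_Int_span_plus)
    then show ?case using p(4) fan_zero_face[OF fan \<tau>] by blast
  qed
qed

text \<open>Two points of the ray that differ by \<open>v\<close> are both close to \<open>S\<close>, hence so is \<open>v\<close>, and then \<open>a\<close>.\<close>

lemma ray_near_subspace:
  fixes S :: "'a::real_normed_vector set"
  assumes S: "subspace S" "closed S"
    and near: "\<And>e. e > 0 \<Longrightarrow> eventually (\<lambda>\<mu>::real. \<exists>u\<in>S. dist u (a + \<mu> *\<^sub>R v) < e) at_top"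
  shows "v \<in> S" "a \<in> S"
proof -
  have "\<exists>u\<in>S. dist u v < e" if "e > 0" for e
  proof -
    have "eventually (\<lambda>\<mu>::real. \<exists>u\<in>S. dist u (a + \<mu> *\<^sub>R v) < e / 2) at_top" using that by (intro near) simp
    then obtain M where M: "\<And>\<mu>::real. \<mu> \<ge> M \<Longrightarrow> \<exists>u\<in>S. dist u (a + \<mu> *\<^sub>R v) < e / 2"
      unfolding eventually_at_top_linorder by blast
    obtain u where u: "u \<in> S" "dist u (a + M *\<^sub>R v) < e / 2" using M[of M] by auto
    obtain w where w: "w \<in> S" "dist w (a + (M + 1) *\<^sub>R v) < e / 2" using M[of "M + 1"] by auto
    have "(w - u) - v = (w - (a + (M + 1) *\<^sub>R v)) - (u - (a + M *\<^sub>R v))" by (simp add: algebra_simps)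
    then have "dist (w - u) v \<le> dist w (a + (M + 1) *\<^sub>R v) + dist u (a + M *\<^sub>R v)"
      unfolding dist_norm by (metis norm_triangle_ineq4)
    then have "dist (w - u) v < e" using u w by linarith
    then show ?thesis using S u w subspace_diff by blast
  qed
  then show v: "v \<in> S" using S(2) closure_approachable[of v S] by simp
  have "\<exists>u\<in>S. dist u a < e" if e: "e > 0" for e
  proof -
    obtain M and u where u: "u \<in> S" "dist u (a + M *\<^sub>R v) < e"
      using near[OF e] unfolding eventually_at_top_linorder by blast
    then have "u - M *\<^sub>R v \<in> S" "dist (u - M *\<^sub>R v) a < e"
      using S v by (auto simp: subspace_diff subspace_mul dist_norm algebra_simps)
    then show ?thesis by blast
  qed
  then show "a \<in> S" using S(2) closure_approachable[of a S] by simp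
qed

text \<open>If a ray converges to a point of \<open>N(\<sigma>)\<close>, this limit can only be the image of the starting point
  under \<open>\<pi>\<^sub>\<sigma>\<close>: for a small ball \<open>\<Omega>\<close> around \<open>x\<close>, the points whose coset lies in \<open>\<Omega> + \<langle>\<sigma>\<rangle>\<close>
  include a neighbourhood of the limit, so the ray comes arbitrarily close to \<open>x + \<langle>\<sigma>\<rangle>\<close>.\<close>

lemma ray_limit_determined:
  assumes fan: "is_fan N \<Sigma>" and \<sigma>: "\<sigma> \<in> \<Sigma>" and x: "x \<in> span N"
    and lim: "filterlim (\<lambda>\<mu>. trop_emb (p + \<mu> *\<^sub>R v)) (nhdsin (trop_toric N \<Sigma>) (trop_proj \<sigma> x)) at_top"
  shows "v \<in> span \<sigma>" "p - x \<in> span \<sigma>"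
proof -
  have near: "eventually (\<lambda>\<mu>. \<exists>u\<in>span \<sigma>. dist u ((p - x) + \<mu> *\<^sub>R v) < e) at_top" if e: "e > 0" for e
  proof -
    \<comment> \<open>the coset lies in \<open>ball x e + \<langle>\<sigma>\<rangle>\<close>; this makes sense in all strata near \<open>N(\<sigma>)\<close> at once\<close>
    let ?P = "\<lambda>b. \<exists>w s. dist x w < e \<and> s \<in> span \<sigma> \<and> snd b \<subseteq> (\<lambda>y. w + s + y) ` span \<sigma>"
    have "eventually ?P (nhdsin (trop_toric N \<Sigma>) (trop_proj \<sigma> x))"
    proof (rule eventually_nhdsin_trop_toricI[OF fan \<sigma> x e])
      fix \<tau> y assume h: "\<tau> \<in> \<Sigma>" "\<tau> face_of \<sigma>" "y \<in> ball x e \<inter> span N + \<sigma>"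
      then obtain w s where "dist x w < e" "s \<in> \<sigma>" "y = w + s" by (auto simp: mem_ball_Int_span_plus)
      moreover have "span \<tau> \<subseteq> span \<sigma>" using face_of_imp_subset[OF h(2)] by (rule span_mono)
      ultimately have "snd (trop_proj \<tau> y) \<subseteq> (\<lambda>y. w + s + y) ` span \<sigma>" "s \<in> span \<sigma>"
        by (auto simp: trop_proj_def span_base)
      then show "?P (trop_proj \<tau> y)" using \<open>dist x w < e\<close> by blast
    qed
    then have "eventually (\<lambda>\<mu>. ?P (trop_emb (p + \<mu> *\<^sub>R v))) at_top"
      by (rule eventually_compose_filterlim[OF _ lim])
    then show ?thesis
    proof eventually_elim
      case (elim \<mu>)
      then obtain w s u where h: "dist x w < e" "s \<in> span \<sigma>" "u \<in> span \<sigma>" "p + \<mu> *\<^sub>R v = w + s + u"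
        by (auto simp: trop_proj_def)
      then have "s + u - (p - x + \<mu> *\<^sub>R v) = x - w" by (simp add: algebra_simps)
      then have "dist (s + u) (p - x + \<mu> *\<^sub>R v) < e" using h(1) by (metis dist_norm)
      then show ?case using h span_add by blast
    qed
  qed
  show "v \<in> span \<sigma>" "p - x \<in> span \<sigma>"
    using ray_near_subspace[OF subspace_span closed_span near] by blast+
qed

section \<open>Semicontinuity and continuity at a point\<close>

lemma continuous_map_ereal_iff_nhdsin:
  assumes U: "openin X U" and \<phi>: "\<phi> \<in> U \<rightarrow> {..<\<infinity>::ereal}"
  shows "continuous_map (subtopology X U) (top_of_set {..<\<infinity>}) \<phi> \<longleftrightarrow> (\<forall>a\<in>U. (\<phi> \<longlongrightarrow> \<phi> a) (nhdsin X a))"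
proof -
  have US: "U \<subseteq> topspace X" using U openin_subset by blast
  have "continuous_map (subtopology X U) (top_of_set {..<\<infinity>}) \<phi> \<longleftrightarrow>
      continuous_map (subtopology X U) euclidean \<phi>"
    using \<phi> US by (auto simp: continuous_map_in_subtopology)
  also have "\<dots> \<longleftrightarrow> (\<forall>a\<in>U. \<forall>V. open V \<and> \<phi> a \<in> V \<longrightarrow> (\<exists>W. openin X W \<and> W \<subseteq> U \<and> a \<in> W \<and> \<phi> ` W \<subseteq> V))"
    using US unfolding continuous_map_atin limitin_atin_self
    by (simp add: openin_open_subtopology[OF U] Int_absorb1 conj_assoc)
  also have "\<dots> \<longleftrightarrow> (\<forall>a\<in>U. (\<phi> \<longlongrightarrow> \<phi> a) (nhdsin X a))"
  proof (intro ball_cong refl iffI)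
    fix a assume a: "a \<in> U" and h: "\<forall>V. open V \<and> \<phi> a \<in> V \<longrightarrow> (\<exists>W. openin X W \<and> W \<subseteq> U \<and> a \<in> W \<and> \<phi> ` W \<subseteq> V)"
    show "(\<phi> \<longlongrightarrow> \<phi> a) (nhdsin X a)"
      unfolding tendsto_def eventually_nhdsin
    proof (intro allI impI disjI2)
      fix V assume "open V" "\<phi> a \<in> V"
      then obtain W where "openin X W" "a \<in> W" "\<phi> ` W \<subseteq> V" using h by blast
      then show "\<exists>W. openin X W \<and> a \<in> W \<and> (\<forall>x\<in>W. \<phi> x \<in> V)" by blast
    qed
  next
    fix a assume a: "a \<in> U" and h: "(\<phi> \<longlongrightarrow> \<phi> a) (nhdsin X a)"
    show "\<forall>V. open V \<and> \<phi> a \<in> V \<longrightarrow> (\<exists>W. openin X W \<and> W \<subseteq> U \<and> a \<in> W \<and> \<phi> ` W \<subseteq> V)"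
    proof (intro allI impI)
      fix V assume "open V \<and> \<phi> a \<in> V"
      then have "eventually (\<lambda>x. \<phi> x \<in> V) (nhdsin X a)" using h by (auto simp: tendsto_def)
      then obtain W where "openin X W" "a \<in> W" "\<forall>x\<in>W. \<phi> x \<in> V"
        using a US by (auto simp: eventually_nhdsin)
      then show "\<exists>W. openin X W \<and> W \<subseteq> U \<and> a \<in> W \<and> \<phi> ` W \<subseteq> V"
        using a U by (intro exI[of _ "W \<inter> U"]) auto
    qed
  qed
  finally show ?thesis .
qed

lemma upper_semicontinuous_on_iff_nhdsin:
  assumes U: "openin X U"
  shows "upper_semicontinuous_on X U \<phi> \<longleftrightarrow>
    (\<forall>a\<in>U. \<forall>r::real. \<phi> a < ereal r \<longrightarrow> eventually (\<lambda>x. \<phi> x < ereal r) (nhdsin X a))"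
proof
  have US: "U \<subseteq> topspace X" using U openin_subset by blast
  assume usc: "upper_semicontinuous_on X U \<phi>"
  show "\<forall>a\<in>U. \<forall>r::real. \<phi> a < ereal r \<longrightarrow> eventually (\<lambda>x. \<phi> x < ereal r) (nhdsin X a)"
  proof (intro ballI allI impI)
    fix a and r :: real assume a: "a \<in> U" "\<phi> a < ereal r"
    have "openin X {x \<in> topspace X \<inter> U. \<phi> x < ereal r}"
      using usc U by (auto simp: upper_semicontinuous_on_def openin_open_subtopology)
    then show "eventually (\<lambda>x. \<phi> x < ereal r) (nhdsin X a)"
      unfolding eventually_nhdsin using a US by blast
  qed
next
  have US: "U \<subseteq> topspace X" using U openin_subset by blast
  assume h: "\<forall>a\<in>U. \<forall>r::real. \<phi> a < ereal r \<longrightarrow> eventually (\<lambda>x. \<phi> x < ereal r) (nhdsin X a)"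
  have "openin X {x \<in> topspace X \<inter> U. \<phi> x < ereal r}" for r
  proof (subst openin_subopen, intro ballI)
    fix a assume a: "a \<in> {x \<in> topspace X \<inter> U. \<phi> x < ereal r}"
    then obtain W where W: "openin X W" "a \<in> W" "\<forall>x\<in>W. \<phi> x < ereal r"
      using h unfolding eventually_nhdsin by blast
    then show "\<exists>T. openin X T \<and> a \<in> T \<and> T \<subseteq> {x \<in> topspace X \<inter> U. \<phi> x < ereal r}"
      using a U US by (intro exI[of _ "W \<inter> U"]) auto
  qed
  then show "upper_semicontinuous_on X U \<phi>"
    unfolding upper_semicontinuous_on_def openin_open_subtopology[OF U] by auto
qed

section \<open>Nonempty open sets have positive measure\<close>

lemma sum_scaleR_in_span: "(\<Sum>b\<in>B. c b *\<^sub>R b) \<in> span B"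
  by (intro span_sum span_mul span_base)

lemma lattice_basis_span:
  assumes "lattice_basis N B"
  shows "span B = span N"
proof
  have N: "N = {\<Sum>b\<in>B. of_int (k b) *\<^sub>R b | k :: 'a \<Rightarrow> int. True}" and fin: "finite B"
    using assms by (auto simp: lattice_basis_def)
  have "b \<in> N" if "b \<in> B" for b
  proof -
    have "(\<Sum>c\<in>B. of_int (if c = b then 1 else 0) *\<^sub>R c) = (\<Sum>c\<in>B. if c = b then c else 0)"
      by (intro sum.cong) auto
    also have "\<dots> = b" using fin that by simp
    finally show ?thesis unfolding N by (intro CollectI exI[of _ "\<lambda>c. if c = b then 1 else 0"]) auto
  qed
  then show "span B \<subseteq> span N" by (intro span_mono) auto
  have "N \<subseteq> span B" unfolding N using sum_scaleR_in_span by auto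
  then show "span N \<subseteq> span B" by (simp add: span_minimal)
qed

text \<open>In coordinates with respect to a lattice basis, a nonempty open set contains a box of side \<open>2 d\<close>,
  whose measure is a power of \<open>2 d\<close>. In rank \<open>0\<close> the box is the single point of the empty
  product and has measure \<open>1\<close>, so the argument covers this case as well.\<close>

lemma lattice_lebesgue_nonempty_open:
  fixes N :: "'a::euclidean_space set"
  assumes N: "is_lattice N" and G: "openin (top_of_set (span N)) G" "G \<noteq> {}" "G \<subseteq> A"
  shows "A \<notin> null_sets (lattice_lebesgue N)"
proof
  assume null: "A \<in> null_sets (lattice_lebesgue N)"
  define B where "B = (SOME B. lattice_basis N B)"
  have B: "lattice_basis N B"
    using N unfolding B_def is_lattice_def by (rule someI_ex)
  then have fin: "finite B" and span: "span B = span N"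
    using lattice_basis_span by (auto simp: lattice_basis_def)
  define T where "T = (\<lambda>c :: 'a \<Rightarrow> real. \<Sum>b\<in>B. c b *\<^sub>R b)"
  let ?L = "\<Pi>\<^sub>M b\<in>B. (lborel :: real measure)"
  let ?R = "restrict_space borel (span N) :: 'a measure"
  have T: "T \<in> measurable ?L ?R"
  proof (rule measurable_restrict_space2)
    show "T \<in> space ?L \<rightarrow> span N"
      unfolding T_def span[symmetric] using sum_scaleR_in_span by auto
    have "(\<lambda>c. c b) \<in> borel_measurable ?L" if "b \<in> B" for b
      using measurable_component_singleton[OF that, of "\<lambda>_. lborel"]
      by (simp add: measurable_cong_sets[OF refl sets_lborel])
    then show "T \<in> borel_measurable ?L"
      unfolding T_def by (intro borel_measurable_sum borel_measurable_scaleR borel_measurable_const)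
  qed
  obtain G' where G': "open G'" "G = span N \<inter> G'" using G(1) by (auto simp: openin_open)
  have Gs: "G \<in> sets ?R" using G' by (auto simp: sets_restrict_space)
  obtain A' where "A' \<in> null_sets (distr ?L ?R T)" "A \<subseteq> A'"
    using null unfolding lattice_lebesgue_def Let_def B_def[symmetric] T_def[symmetric]
      null_sets_completion_iff2 by blast
  then have "G \<in> null_sets (distr ?L ?R T)"
    using G(3) Gs null_sets_subset[of A' "distr ?L ?R T" G] by auto
  then have zero: "emeasure ?L (T -` G \<inter> space ?L) = 0"
    using emeasure_distr[OF T Gs] by (simp add: null_sets_def)
  obtain x where x: "x \<in> G" using G(2) by blast
  then obtain e where e: "e > 0" "ball x e \<subseteq> G'"
    using G' by (auto simp: open_contains_ball)
  have "x \<in> span B" using x G' span by auto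
  then obtain c where c: "x = (\<Sum>b\<in>B. c b *\<^sub>R b)" using span_finite[OF fin] by auto
  \<comment> \<open>moving every coordinate by at most \<open>e / m\<close> moves the point by less than \<open>e\<close>\<close>
  define m where "m = 1 + (\<Sum>b\<in>B. norm b)"
  have m: "m \<ge> 1" unfolding m_def by (simp add: sum_nonneg)
  define d where "d = e / m"
  have d: "d > 0" using e m by (simp add: d_def)
  let ?box = "Pi\<^sub>E B (\<lambda>b. {c b - d <..< c b + d})"
  have box: "?box \<subseteq> T -` G \<inter> space ?L"
  proof
    fix c' assume c': "c' \<in> ?box"
    have "norm (T c' - x) = norm (\<Sum>b\<in>B. (c' b - c b) *\<^sub>R b)"
      unfolding T_def c by (simp add: sum_subtractf scaleR_diff_left)
    also have "\<dots> \<le> (\<Sum>b\<in>B. d * norm b)"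
    proof (rule sum_norm_le)
      fix b assume "b \<in> B"
      then have "\<bar>c' b - c b\<bar> \<le> d" using c' by (force simp: PiE_iff abs_le_iff)
      then show "norm ((c' b - c b) *\<^sub>R b) \<le> d * norm b" by (simp add: mult_right_mono)
    qed
    also have "\<dots> = d * (m - 1)" by (simp add: m_def sum_distrib_left)
    also have "\<dots> < d * m" using d by simp
    also have "\<dots> = e" using m by (simp add: d_def)
    finally have "T c' \<in> ball x e" by (simp add: dist_norm norm_minus_commute)
    moreover have sp: "c' \<in> space ?L" using c' by (auto simp: space_PiM PiE_iff)
    moreover have "T c' \<in> span N" using measurable_space[OF T sp] by (simp add: space_restrict_space)
    ultimately show "c' \<in> T -` G \<inter> space ?L" using e G' by auto
  qed
  interpret product_sigma_finite "\<lambda>_::'a. lborel :: real measure" ..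
  have "emeasure ?L ?box = (\<Prod>b\<in>B. emeasure lborel {c b - d <..< c b + d})"
    using fin by (rule emeasure_PiM) auto
  also have "\<dots> = (\<Prod>b\<in>B. ennreal (2 * d))" using d by (intro prod.cong) auto
  also have "\<dots> = ennreal ((2 * d) ^ card B)" using d by (simp add: ennreal_power)
  finally have "emeasure ?L ?box > 0" using d by simp
  moreover have "emeasure ?L ?box \<le> emeasure ?L (T -` G \<inter> space ?L)"
    by (rule emeasure_mono[OF box measurable_sets[OF T Gs]])
  ultimately show False using zero by simp
qed

section \<open>Plurisubharmonic functions are continuous\<close>

lemma finite_partI: "trop_emb x \<in> U \<Longrightarrow> x \<in> span N \<Longrightarrow> x \<in> finite_part N U"
  by (simp add: finite_part_def)

lemma convex_on_finite_part_epi_convex: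
  "convex_on_finite_part N U \<phi> \<Longrightarrow> epi_convex (finite_part N U) (\<phi> \<circ> trop_emb)"
  unfolding convex_on_finite_part_def by (rule convex_minf_imp_epi_convex)

lemma psh_le_along_ray:
  assumes fan: "is_fan N \<Sigma>" and U: "openin (trop_toric N \<Sigma>) U" and psh: "psh N \<Sigma> U \<phi>"
    and \<tau>: "\<tau> \<in> \<Sigma>" and y: "y \<in> span N" and v: "v \<in> rel_interior \<tau>"
    and ray: "\<And>\<mu>. \<mu> \<ge> 0 \<Longrightarrow> trop_emb (y + \<mu> *\<^sub>R v) \<in> U" and yU: "trop_proj \<tau> y \<in> U"
  shows "\<phi> (trop_proj \<tau> y) \<le> \<phi> (trop_emb y)"
proof -
  have "limitin (trop_toric N \<Sigma>) (\<lambda>\<mu>. trop_emb (y + \<mu> *\<^sub>R v)) (trop_proj \<tau> y) at_top"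
    unfolding limitin_iff_filterlim_nhdsin
    using ray_tends_to_projection[OF fan \<tau> y v] openin_subset[OF U] yU by blast
  moreover have "v \<in> \<Union>\<Sigma>" using v \<tau> rel_interior_subset by blast
  ultimately show ?thesis using psh y ray yU unfolding psh_def by blast
qed

lemma usc_along_ray:
  assumes fan: "is_fan N \<Sigma>" and U: "openin (trop_toric N \<Sigma>) U"
    and usc: "upper_semicontinuous_on (trop_toric N \<Sigma>) U \<phi>"
    and \<tau>: "\<tau> \<in> \<Sigma>" and y: "y \<in> span N" and v: "v \<in> rel_interior \<tau>"
    and yU: "trop_proj \<tau> y \<in> U" and r: "\<phi> (trop_proj \<tau> y) < ereal r"
  shows "eventually (\<lambda>\<mu>. \<phi> (trop_emb (y + \<mu> *\<^sub>R v)) < ereal r) at_top"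
proof -
  have "eventually (\<lambda>x. \<phi> x < ereal r) (nhdsin (trop_toric N \<Sigma>) (trop_proj \<tau> y))"
    using usc yU r unfolding upper_semicontinuous_on_iff_nhdsin[OF U] by blast
  then show ?thesis
    by (rule eventually_compose_filterlim[OF _ ray_tends_to_projection[OF fan \<tau> y v]])
qed

lemma cone_rel_interior_nonempty:
  assumes "is_fan N \<Sigma>" "\<sigma> \<in> \<Sigma>"
  obtains v where "v \<in> rel_interior \<sigma>" "v \<in> \<sigma>"
  using fan_cone(1)[OF assms] rel_interior_eq_empty[of \<sigma>] rel_interior_subset[of \<sigma>]
  by (auto simp: convex_cone_def)

lemma plus_cone_closed:
  assumes c: "convex_cone \<sigma>" and x: "x \<in> A + \<sigma>" and s: "s \<in> \<sigma>" "\<mu> \<ge> 0"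
  shows "x + \<mu> *\<^sub>R s \<in> A + \<sigma>"
proof -
  obtain a t where "a \<in> A" "t \<in> \<sigma>" "x = a + t" using x by (auto simp: set_plus_def)
  moreover from this have "t + \<mu> *\<^sub>R s \<in> \<sigma>" using c s by (simp add: convex_cone_iff)
  ultimately show ?thesis using set_plus_intro[of a A "t + \<mu> *\<^sub>R s" \<sigma>] by (simp add: add.assoc)
qed

text \<open>Let \<open>a\<close> lie in \<open>N(\<sigma>)\<close> and put \<open>g x = \<phi> (\<pi>\<^sub>\<sigma> x)\<close> on a small convex open set \<open>D\<close> around a representative
  of \<open>a\<close>. For \<open>v\<close> in the relative interior of \<open>\<sigma>\<close>, the third psh condition and upper semicontinuity
  show that \<open>g x\<close> is the limit of \<open>\<phi> (x + \<mu> v)\<close>. So \<open>g\<close> is convex, hence continuous. The same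
  description for a face \<open>\<tau>\<close>, together with \<open>g (x + \<mu> u) = g x\<close> for \<open>u \<in> \<tau>\<close>, gives
  \<open>g x \<le> \<phi> (\<pi>\<^sub>\<tau> x)\<close>. Thus the continuous function \<open>g\<close> bounds \<open>\<phi>\<close> from below on a whole neighbourhood
  of \<open>a\<close>, with equality at \<open>a\<close>, and this is lower semicontinuity.\<close>

lemma psh_imp_continuous_at:
  fixes N :: "'a::euclidean_space set"
  assumes fan: "is_fan N \<Sigma>" and U: "openin (trop_toric N \<Sigma>) U"
    and fin: "\<phi> \<in> U \<rightarrow> {..<\<infinity>}" and psh: "psh N \<Sigma> U \<phi>" and a: "a \<in> U"
  shows "(\<phi> \<longlongrightarrow> \<phi> a) (nhdsin (trop_toric N \<Sigma>) a)"
proof -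
  have usc: "upper_semicontinuous_on (trop_toric N \<Sigma>) U \<phi>"
    and conv: "epi_convex (finite_part N U) (\<phi> \<circ> trop_emb)"
    using psh convex_on_finite_part_epi_convex by (auto simp: psh_def)
  obtain \<sigma> q where \<sigma>: "\<sigma> \<in> \<Sigma>" and q: "q \<in> span N" "a = trop_proj \<sigma> q"
    using trop_point_cases[OF fan U a] .
  obtain p e where p: "p \<in> span N" "a = trop_proj \<sigma> p" "e > 0"
    and inU: "\<And>\<tau> x. \<tau> \<in> \<Sigma> \<Longrightarrow> \<tau> face_of \<sigma> \<Longrightarrow> x \<in> ball p e \<inter> span N + \<sigma> \<Longrightarrow> trop_proj \<tau> x \<in> U"
    using eventually_nhdsin_trop_toricE[OF fan \<sigma> q(1)] openin_imp_eventually_nhdsin[OF U a]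
    unfolding q(2) by metis
  note c\<sigma> = fan_cone[OF fan \<sigma>] and z = fan_zero_face[OF fan \<sigma>] and refl = fan_face_of_refl[OF fan \<sigma>]
  define D where "D = ball p e \<inter> span N"
  have D: "convex D" "openin (top_of_set (span N)) D" "D \<subseteq> span N"
    using openin_open_Int[of "ball p e" "span N"]
    by (simp_all add: D_def convex_Int subspace_imp_convex Int_commute)
  note inU = inU[folded D_def]
  have DS: "x \<in> D + \<sigma>" if "x \<in> D" for x
    using set_plus_intro[OF that convex_cone_contains_0[OF c\<sigma>(1)]] by simp
  have DSN: "x \<in> span N" if "x \<in> D + \<sigma>" for x
    using that D(3) c\<sigma>(2) by (auto simp: set_plus_def intro!: span_add)
  have ray: "trop_emb (x + \<mu> *\<^sub>R s) \<in> U" if "x \<in> D + \<sigma>" "s \<in> \<sigma>" "\<mu> \<ge> 0" for x s \<mu>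
    using inU[OF z plus_cone_closed[OF c\<sigma>(1) that]] .
  \<comment> \<open>\<open>g\<close> is \<open>\<phi>\<close> on the stratum of \<open>a\<close>, read on representatives\<close>
  define g where "g = (\<lambda>x. \<phi> (trop_proj \<sigma> x))"
  obtain v where v: "v \<in> rel_interior \<sigma>" "v \<in> \<sigma>" using cone_rel_interior_nonempty[OF fan \<sigma>] .
  have g_shift: "g (x + u) = g x" if "u \<in> \<sigma>" for x u
  proof -
    have "trop_proj \<sigma> (x + u) = trop_proj \<sigma> x" using that by (simp add: trop_proj_eq_iff span_base)
    then show ?thesis by (simp add: g_def)
  qed
  have g_le: "g x \<le> \<phi> (trop_emb x)" if x: "x \<in> D + \<sigma>" for x
    unfolding g_def
    by (rule psh_le_along_ray[OF fan U psh \<sigma> DSN[OF x] v(1) ray[OF x v(2)] inU[OF \<sigma> refl x]])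
  have g_usc: "eventually (\<lambda>\<mu>. \<phi> (trop_emb (x + \<mu> *\<^sub>R v)) < ereal r) at_top"
    if x: "x \<in> D" "g x < ereal r" for x r
    using usc_along_ray[OF fan U usc \<sigma> DSN[OF DS[OF x(1)]] v(1) inU[OF \<sigma> refl DS[OF x(1)]]] x(2)
    by (simp add: g_def)
  have g_conv: "epi_convex D g"
    unfolding epi_convex_def
  proof (intro allI impI, elim conjE)
    fix x y and t r s :: real
    assume h: "x \<in> D" "y \<in> D" "t \<in> {0..1}" "g x < ereal r" "g y < ereal s"
    have "eventually (\<lambda>\<mu>. \<mu> \<ge> 0 \<and> \<phi> (trop_emb (x + \<mu> *\<^sub>R v)) < ereal r \<and>
        \<phi> (trop_emb (y + \<mu> *\<^sub>R v)) < ereal s) at_top"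
      using g_usc[OF h(1,4)] g_usc[OF h(2,5)] eventually_ge_at_top[of 0] by eventually_elim auto
    then obtain \<mu> where \<mu>: "\<mu> \<ge> 0" "\<phi> (trop_emb (x + \<mu> *\<^sub>R v)) < ereal r"
        "\<phi> (trop_emb (y + \<mu> *\<^sub>R v)) < ereal s"
      using eventually_happens[of _ "at_top :: real filter"] by auto
    have V: "w + \<mu> *\<^sub>R v \<in> finite_part N U" if "w \<in> D" for w
      using ray[OF DS[OF that] v(2) \<mu>(1)] DSN[OF plus_cone_closed[OF c\<sigma>(1) DS[OF that] v(2) \<mu>(1)]]
      by (rule finite_partI)
    \<comment> \<open>push the segment far along \<open>v\<close>, where \<open>\<phi>\<close> is convex and close to \<open>g\<close>\<close>
    have comb: "(1 - u) *\<^sub>R (x + \<mu> *\<^sub>R v) + u *\<^sub>R (y + \<mu> *\<^sub>R v) = ((1 - u) *\<^sub>R x + u *\<^sub>R y) + \<mu> *\<^sub>R v" for u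
      by (simp add: algebra_simps)
    have zD: "(1 - u) *\<^sub>R x + u *\<^sub>R y \<in> D" if "u \<in> {0..1}" for u
      using convexD_alt[OF D(1) h(1,2)] that by simp
    have "closed_segment (x + \<mu> *\<^sub>R v) (y + \<mu> *\<^sub>R v) \<subseteq> finite_part N U"
      using V zD comb by (auto simp: closed_segment_def)
    then have "(\<phi> \<circ> trop_emb) ((1 - t) *\<^sub>R (x + \<mu> *\<^sub>R v) + t *\<^sub>R (y + \<mu> *\<^sub>R v)) \<le> ereal ((1 - t) * r + t * s)"
      using h \<mu> V by (intro epi_convexD[OF conv]) auto
    moreover have "g ((1 - t) *\<^sub>R x + t *\<^sub>R y) \<le> \<phi> (trop_emb (((1 - t) *\<^sub>R x + t *\<^sub>R y) + \<mu> *\<^sub>R v))"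
      using g_le[OF plus_cone_closed[OF c\<sigma>(1) DS[OF zD[OF h(3)]] v(2) \<mu>(1)]]
        g_shift[of "\<mu> *\<^sub>R v"] c\<sigma>(1) v(2) \<mu>(1) by (simp add: convex_cone_iff)
    ultimately show "g ((1 - t) *\<^sub>R x + t *\<^sub>R y) \<le> ereal ((1 - t) * r + t * s)"
      by (simp add: comb)
  qed
  have g_cont: "continuous_on D g"
    using fin inU[OF \<sigma> refl DS]
    by (intro epi_convex_continuous_on[OF subspace_span D(2) g_conv]) (auto simp: g_def Pi_iff)
  have g_le_lower_stratum: "g x \<le> \<phi> (trop_proj \<tau> x)" if \<tau>: "\<tau> \<in> \<Sigma>" "\<tau> face_of \<sigma>" and x: "x \<in> D + \<sigma>" for \<tau> x
  proof (rule ccontr)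
    assume "\<not> g x \<le> \<phi> (trop_proj \<tau> x)"
    then obtain r where r: "\<phi> (trop_proj \<tau> x) < ereal r" "ereal r < g x"
      using ereal_dense2 by (metis not_le)
    obtain u where u: "u \<in> rel_interior \<tau>" "u \<in> \<tau>" using cone_rel_interior_nonempty[OF fan \<tau>(1)] .
    have "u \<in> \<sigma>" using u(2) face_of_imp_subset[OF \<tau>(2)] by blast
    have "eventually (\<lambda>\<mu>. \<mu> \<ge> 0 \<and> \<phi> (trop_emb (x + \<mu> *\<^sub>R u)) < ereal r) at_top"
      using usc_along_ray[OF fan U usc \<tau>(1) DSN[OF x] u(1) inU[OF \<tau> x] r(1)] eventually_ge_at_top[of 0]
      by eventually_elim auto
    then obtain \<mu> where \<mu>: "\<mu> \<ge> 0" "\<phi> (trop_emb (x + \<mu> *\<^sub>R u)) < ereal r"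
      using eventually_happens[of _ "at_top :: real filter"] by auto
    have "g x = g (x + \<mu> *\<^sub>R u)"
      using g_shift[of "\<mu> *\<^sub>R u"] c\<sigma>(1) \<open>u \<in> \<sigma>\<close> \<mu>(1) by (simp add: convex_cone_iff)
    also have "\<dots> \<le> \<phi> (trop_emb (x + \<mu> *\<^sub>R u))"
      using g_le plus_cone_closed[OF c\<sigma>(1) x \<open>u \<in> \<sigma>\<close> \<mu>(1)] by blast
    finally show False using \<mu>(2) r(2) by simp
  qed
  show ?thesis
  proof (rule order_tendstoI)
    fix r assume r: "r < \<phi> a"
    have pD: "p \<in> D" using p by (simp add: D_def)
    have "openin (top_of_set D) (D \<inter> g -` {r<..})"
      using g_cont by (simp add: continuous_openin_preimage_gen)
    then have "openin (top_of_set (span N)) (D \<inter> g -` {r<..})" using D(2) openin_trans by blast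
    moreover have "p \<in> D \<inter> g -` {r<..}" using pD r by (simp add: p(2) g_def)
    ultimately obtain d where d: "d > 0" "ball p d \<inter> span N \<subseteq> D \<inter> g -` {r<..}"
      by (rule openin_obtain_ball)
    show "eventually (\<lambda>x. r < \<phi> x) (nhdsin (trop_toric N \<Sigma>) a)"
      unfolding p(2)
    proof (rule eventually_nhdsin_trop_toricI[OF fan \<sigma> p(1) d(1)])
      fix \<tau> x assume \<tau>: "\<tau> \<in> \<Sigma>" "\<tau> face_of \<sigma>" and x: "x \<in> ball p d \<inter> span N + \<sigma>"
      then obtain w s where w: "w \<in> ball p d \<inter> span N" "s \<in> \<sigma>" "x = w + s" by (auto simp: set_plus_def)
      then have "r < g x" "x \<in> D + \<sigma>" using d(2) g_shift by auto
      then show "r < \<phi> (trop_proj \<tau> x)" using g_le_lower_stratum[OF \<tau>] by (meson less_le_trans)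
    qed
  next
    fix r assume "\<phi> a < r"
    then obtain r' where "\<phi> a < ereal r'" "ereal r' < r" using ereal_dense2 by blast
    then show "eventually (\<lambda>x. \<phi> x < r) (nhdsin (trop_toric N \<Sigma>) a)"
      using usc a unfolding upper_semicontinuous_on_iff_nhdsin[OF U]
      by (metis (mono_tags, lifting) eventually_mono less_trans)
  qed
qed

section \<open>Continuity, strong semicontinuity and upper limits\<close>

text \<open>Every neighbourhood contains a nonempty open subset of the finite part, which is not null.\<close>

lemma nhdsin_avoiding_null_set_nontrivial:
  assumes N: "is_lattice N" and fan: "is_fan N \<Sigma>" and U: "openin (trop_toric N \<Sigma>) U"
    and E: "null_subset N E" and a: "a \<in> U"
  shows "inf (nhdsin (trop_toric N \<Sigma>) a) (principal (U - E)) \<noteq> bot"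
proof
  assume "inf (nhdsin (trop_toric N \<Sigma>) a) (principal (U - E)) = bot"
  then have "eventually (\<lambda>x. x \<notin> U - E) (nhdsin (trop_toric N \<Sigma>) a)"
    by (simp add: trivial_limit_def eventually_inf_principal)
  then have ev: "eventually (\<lambda>x. x \<in> E) (nhdsin (trop_toric N \<Sigma>) a)"
    using openin_imp_eventually_nhdsin[OF U a] by eventually_elim auto
  obtain \<sigma> q where \<sigma>: "\<sigma> \<in> \<Sigma>" and q: "q \<in> span N" "a = trop_proj \<sigma> q"
    using trop_point_cases[OF fan U a] .
  obtain p e where p: "p \<in> span N" "e > 0"
    and inE: "\<And>\<tau> x. \<tau> \<in> \<Sigma> \<Longrightarrow> \<tau> face_of \<sigma> \<Longrightarrow> x \<in> ball p e \<inter> span N + \<sigma> \<Longrightarrow> trop_proj \<tau> x \<in> E"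
    using eventually_nhdsin_trop_toricE[OF fan \<sigma> q(1)] ev unfolding q(2) by metis
  have "x \<in> finite_part N E" if x: "x \<in> ball p e \<inter> span N" for x
    using set_plus_intro[OF x convex_cone_contains_0[OF fan_cone(1)[OF fan \<sigma>]]]
      inE[OF fan_zero_face[OF fan \<sigma>], of x] x by (simp add: finite_part_def)
  moreover have "openin (top_of_set (span N)) (ball p e \<inter> span N)"
    using openin_open_Int[of "ball p e" "span N"] by (simp add: Int_commute)
  moreover have "p \<in> ball p e \<inter> span N" using p by simp
  ultimately show False
    using lattice_lebesgue_nonempty_open[OF N] E unfolding null_subset_def by blast
qed

lemma continuous_imp_strongly_usc:
  assumes N: "is_lattice N" and fan: "is_fan N \<Sigma>" and U: "openin (trop_toric N \<Sigma>) U"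
    and cont: "\<And>a. a \<in> U \<Longrightarrow> (\<phi> \<longlongrightarrow> \<phi> a) (nhdsin (trop_toric N \<Sigma>) a)"
  shows "strongly_usc N \<Sigma> U \<phi>"
  unfolding strongly_usc_def limsup_within_def
proof (intro allI impI ballI)
  fix E a assume E: "E \<subseteq> U \<and> null_subset N E" and a: "a \<in> U"
  have "Limsup (inf (nhdsin (trop_toric N \<Sigma>) a) (principal (U - E))) \<phi> = \<phi> a"
    using nhdsin_avoiding_null_set_nontrivial[OF N fan U _ a] E
    by (intro lim_imp_Limsup tendsto_mono[OF inf_le1 cont[OF a]]) auto
  then show "\<phi> a = Limsup (inf (nhdsin (trop_toric N \<Sigma>) a) (principal (U - E))) \<phi>" ..
qed

text \<open>The complement of the open stratum is itself a null set.\<close>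

lemma strongly_usc_imp_limsup_over_finite_part:
  assumes "strongly_usc N \<Sigma> U \<phi>" and x: "x \<in> U"
  shows "\<phi> x = limsup_within (trop_toric N \<Sigma>) x (U \<inter> trop_emb ` span N) \<phi>"
proof -
  let ?E = "U - trop_emb ` span N"
  have "finite_part N ?E = {}" by (auto simp: finite_part_def)
  then have "null_subset N ?E" by (simp add: null_subset_def)
  moreover have "U - ?E = U \<inter> trop_emb ` span N" by blast
  ultimately show ?thesis using assms unfolding strongly_usc_def by (metis Diff_subset)
qed

section \<open>Recovering the psh property from upper limits\<close>

lemma finite_stratum_imp_zero_cone:
  assumes "trop_proj \<tau> x \<in> trop_emb ` span N"
  shows "\<tau> = {0}"
  using assms by (auto simp: trop_proj_def)

lemma finite_part_convex_continuous_on: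
  fixes N :: "'a::euclidean_space set"
  assumes fan: "is_fan N \<Sigma>" and U: "openin (trop_toric N \<Sigma>) U"
    and fin: "\<phi> \<in> U \<rightarrow> {..<\<infinity>}" and conv: "convex_on_finite_part N U \<phi>"
  shows "continuous_on (finite_part N U) (\<phi> \<circ> trop_emb)"
  using fin by (intro epi_convex_continuous_on[OF subspace_span openin_finite_part[OF fan U]
        convex_on_finite_part_epi_convex[OF conv]]) (auto simp: finite_part_def Pi_iff)

lemma finite_part_convex_less_open:
  fixes N :: "'a::euclidean_space set"
  assumes fan: "is_fan N \<Sigma>" and U: "openin (trop_toric N \<Sigma>) U"
    and fin: "\<phi> \<in> U \<rightarrow> {..<\<infinity>}" and conv: "convex_on_finite_part N U \<phi>"
    and x: "x \<in> finite_part N U" "\<phi> (trop_emb x) < r"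
  obtains d where "d > 0" "\<And>y. y \<in> ball x d \<inter> span N \<Longrightarrow> y \<in> finite_part N U \<and> \<phi> (trop_emb y) < r"
proof -
  let ?V = "finite_part N U"
  have "openin (top_of_set ?V) (?V \<inter> (\<phi> \<circ> trop_emb) -` {..<r})"
    using finite_part_convex_continuous_on[OF fan U fin conv]
    by (simp add: continuous_openin_preimage_gen)
  then have "openin (top_of_set (span N)) (?V \<inter> (\<phi> \<circ> trop_emb) -` {..<r})"
    using openin_finite_part[OF fan U] openin_trans by blast
  moreover have "x \<in> ?V \<inter> (\<phi> \<circ> trop_emb) -` {..<r}" using x by simp
  ultimately obtain d where "d > 0" "ball x d \<inter> span N \<subseteq> ?V \<inter> (\<phi> \<circ> trop_emb) -` {..<r}"
    by (rule openin_obtain_ball)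
  then show thesis by (intro that[of d]) auto
qed

text \<open>At finite points convexity gives continuity. Elsewhere, a bound for \<open>\<phi>\<close> on the finite points of an
  open set passes to its remaining points, because their values are upper limits of finite ones; the
  two bounds \<open>r' < r\<close> make up for the strict inequality lost in this passage.\<close>

lemma limsup_finite_part_imp_usc:
  fixes N :: "'a::euclidean_space set"
  assumes fan: "is_fan N \<Sigma>" and U: "openin (trop_toric N \<Sigma>) U"
    and fin: "\<phi> \<in> U \<rightarrow> {..<\<infinity>}" and conv: "convex_on_finite_part N U \<phi>"
    and lims: "\<And>x. x \<in> U - trop_emb ` span N \<Longrightarrow>
      \<phi> x = limsup_within (trop_toric N \<Sigma>) x (U \<inter> trop_emb ` span N) \<phi>"
  shows "upper_semicontinuous_on (trop_toric N \<Sigma>) U \<phi>"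
  unfolding upper_semicontinuous_on_iff_nhdsin[OF U]
proof (intro ballI allI impI)
  fix a and r :: real assume a: "a \<in> U" and r: "\<phi> a < ereal r"
  show "eventually (\<lambda>x. \<phi> x < ereal r) (nhdsin (trop_toric N \<Sigma>) a)"
  proof (cases "a \<in> trop_emb ` span N")
    case True
    then obtain x where x: "x \<in> span N" "a = trop_emb x" by blast
    then have xV: "x \<in> finite_part N U" using a by (simp add: finite_part_def)
    obtain d where d: "d > 0" "\<And>y. y \<in> ball x d \<inter> span N \<Longrightarrow> y \<in> finite_part N U \<and> \<phi> (trop_emb y) < ereal r"
      using finite_part_convex_less_open[OF fan U fin conv xV, of "ereal r"] r x(2) by blast
    obtain \<sigma> q where "\<sigma> \<in> \<Sigma>" "a = trop_proj \<sigma> q" using trop_point_cases[OF fan U a] .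
    then have z: "{0} \<in> \<Sigma>" using fan_zero_face(1)[OF fan] by blast
    show ?thesis
      unfolding x(2)
    proof (rule eventually_nhdsin_trop_toricI[OF fan z x(1) d(1)])
      fix \<tau> y assume h: "\<tau> \<in> \<Sigma>" "\<tau> face_of {0}" "y \<in> ball x d \<inter> span N + {0}"
      have "0 \<in> \<tau>" using fan_cone(1)[OF fan h(1)] convex_cone_contains_0 by blast
      then have "\<tau> = {0}" using face_of_imp_subset[OF h(2)] by blast
      moreover have "y \<in> ball x d \<inter> span N" using h(3) by (auto simp: set_plus_def)
      ultimately show "\<phi> (trop_proj \<tau> y) < ereal r" using d(2) by blast
    qed
  next
    case False
    obtain r' where r': "\<phi> a < ereal r'" "ereal r' < ereal r" using ereal_dense2[OF r] by blast
    have "eventually (\<lambda>x. x \<in> U \<inter> trop_emb ` span N \<longrightarrow> \<phi> x < ereal r') (nhdsin (trop_toric N \<Sigma>) a)"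
      using r'(1) lims[of a] a False Limsup_lessD
      unfolding limsup_within_def eventually_inf_principal[symmetric] by (metis DiffI)
    then obtain W where W: "openin (trop_toric N \<Sigma>) W" "a \<in> W"
      "\<And>x. x \<in> W \<Longrightarrow> x \<in> U \<inter> trop_emb ` span N \<Longrightarrow> \<phi> x < ereal r'"
      using openin_subset[OF U] a unfolding eventually_nhdsin by blast
    have "\<phi> b < ereal r" if b: "b \<in> W" "b \<in> U" for b
    proof (cases "b \<in> trop_emb ` span N")
      case True
      then show ?thesis using W(3)[of b] b r'(2) less_trans by blast
    next
      case False
      have "eventually (\<lambda>x. x \<in> U \<inter> trop_emb ` span N \<longrightarrow> \<phi> x \<le> ereal r') (nhdsin (trop_toric N \<Sigma>) b)"
        using openin_imp_eventually_nhdsin[OF W(1) b(1)] by eventually_elim (use W(3) in \<open>auto intro: less_imp_le\<close>)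
      then have "\<phi> b \<le> ereal r'"
        using lims[of b] b(2) False
        by (simp add: limsup_within_def Limsup_bounded eventually_inf_principal)
      then show ?thesis using r'(2) by (rule le_less_trans)
    qed
    then show ?thesis
      using openin_imp_eventually_nhdsin[OF openin_Int[OF W(1) U], of a] W(2) a
      by (auto elim: eventually_mono)
  qed
qed

text \<open>The inequality along a ray from \<open>p\<close> to a boundary point \<open>q\<close> of the stratum \<open>N(\<sigma>)\<close> is the substance.
  Near \<open>q\<close> the function is bounded above, and the finite part of a neighbourhood is stable under
  adding \<open>\<sigma>\<close>; hence \<open>\<phi>\<close> does not increase along directions of \<open>\<sigma>\<close> there, nor along the ray itself.
  If \<open>\<phi> p < r\<close>, then \<open>\<phi> < r\<close> at a point \<open>p'\<close> far out on the ray, by continuity on a ball around \<open>p'\<close>,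
  and by monotonicity on the sum of this ball with \<open>\<sigma>\<close>. This sum is the finite part of a neighbourhood
  of \<open>q\<close>, so the upper limit \<open>\<phi> q\<close> is at most \<open>r\<close>.\<close>

lemma limsup_finite_part_imp_psh:
  fixes N :: "'a::euclidean_space set"
  assumes fan: "is_fan N \<Sigma>" and U: "openin (trop_toric N \<Sigma>) U"
    and fin: "\<phi> \<in> U \<rightarrow> {..<\<infinity>}" and conv: "convex_on_finite_part N U \<phi>"
    and lims: "\<And>x. x \<in> U - trop_emb ` span N \<Longrightarrow>
      \<phi> x = limsup_within (trop_toric N \<Sigma>) x (U \<inter> trop_emb ` span N) \<phi>"
  shows "psh N \<Sigma> U \<phi>"
  unfolding psh_def
proof (intro conjI ballI allI impI)
  show usc: "upper_semicontinuous_on (trop_toric N \<Sigma>) U \<phi>"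
    by (rule limsup_finite_part_imp_usc[OF fan U fin conv lims])
  show "convex_on_finite_part N U \<phi>" by (rule conv)
  note epi = convex_on_finite_part_epi_convex[OF conv]
  fix p v q
  assume p: "p \<in> span N" and v: "v \<in> \<Union>\<Sigma>"
    and lim: "limitin (trop_toric N \<Sigma>) (\<lambda>\<mu>. trop_emb (p + \<mu> *\<^sub>R v)) q at_top"
    and "(\<forall>\<mu>\<ge>0. trop_emb (p + \<mu> *\<^sub>R v) \<in> U) \<and> q \<in> U"
  then have ray: "\<And>\<mu>. \<mu> \<ge> 0 \<Longrightarrow> trop_emb (p + \<mu> *\<^sub>R v) \<in> U" and qU: "q \<in> U" by auto
  have vN: "v \<in> span N" using v fan_cone(2)[OF fan] by blast
  obtain \<sigma> x where \<sigma>: "\<sigma> \<in> \<Sigma>" and x: "x \<in> span N" "q = trop_proj \<sigma> x"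
    using trop_point_cases[OF fan U qU] .
  note c\<sigma> = fan_cone[OF fan \<sigma>] and z = fan_zero_face[OF fan \<sigma>]
  have flim: "filterlim (\<lambda>\<mu>. trop_emb (p + \<mu> *\<^sub>R v)) (nhdsin (trop_toric N \<Sigma>) q) at_top"
    using lim by (simp add: limitin_iff_filterlim_nhdsin)
  have "v \<in> span \<sigma>" "p - x \<in> span \<sigma>"
    using ray_limit_determined[OF fan \<sigma> x(1) flim[unfolded x(2)]] by blast+
  then have q: "q = trop_proj \<sigma> (p + \<mu> *\<^sub>R v)" for \<mu>
  proof -
    have "x - (p + \<mu> *\<^sub>R v) = - (p - x) - \<mu> *\<^sub>R v" by simp
    then show ?thesis
      using \<open>v \<in> span \<sigma>\<close> \<open>p - x \<in> span \<sigma>\<close> span_diff[OF span_neg span_mul]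
      by (metis x(2) trop_proj_eq_iff)
  qed
  show "\<phi> q \<le> \<phi> (trop_emb p)"
  proof (cases "q \<in> trop_emb ` span N")
    case True
    then show ?thesis using q[of 0] finite_stratum_imp_zero_cone[of \<sigma> x N] x(2) by simp
  next
    case False
    obtain M where M: "\<phi> q < ereal M" using fin qU by (metis PiE ereal_dense2 lessThan_iff)
    have ev: "eventually (\<lambda>y. y \<in> U \<and> \<phi> y < ereal M) (nhdsin (trop_toric N \<Sigma>) q)"
      using usc M qU openin_imp_eventually_nhdsin[OF U qU]
      unfolding upper_semicontinuous_on_iff_nhdsin[OF U] by (auto intro: eventually_conj)
    obtain x' e where x': "x' \<in> span N" "trop_proj \<sigma> x = trop_proj \<sigma> x'" "e > 0"
      and near: "\<And>\<tau> y. \<tau> \<in> \<Sigma> \<Longrightarrow> \<tau> face_of \<sigma> \<Longrightarrow> y \<in> ball x' e \<inter> span N + \<sigma> \<Longrightarrow>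
        trop_proj \<tau> y \<in> U \<and> \<phi> (trop_proj \<tau> y) < ereal M"
      by (rule eventually_nhdsin_trop_toricE[OF fan \<sigma> x(1) ev[unfolded x(2)]]) blast
    define D where "D = ball x' e \<inter> span N"
    note near = near[OF z, folded D_def]
    have DSN: "y \<in> span N" if "y \<in> D + \<sigma>" for y
      using that c\<sigma>(2) by (auto simp: D_def set_plus_def intro!: span_add)
    have "eventually (\<lambda>\<mu>. trop_emb (p + \<mu> *\<^sub>R v) \<in> basic_nbhd \<Sigma> \<sigma> D) at_top"
      using openin_imp_eventually_nhdsin[OF openin_basic_nbhd_ball[OF fan \<sigma>]
          trop_proj_in_basic_nbhd_ball[OF fan \<sigma> x'(1,3)]] flim
      unfolding D_def x(2) x'(2) by (rule eventually_compose_filterlim)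
    then have evD: "eventually (\<lambda>\<mu>. p + \<mu> *\<^sub>R v \<in> D + \<sigma>) at_top"
    proof eventually_elim
      case (elim \<mu>)
      then obtain \<tau> y where y: "y \<in> D + \<sigma>" "trop_emb (p + \<mu> *\<^sub>R v) = trop_proj \<tau> y"
        by (auto simp: basic_nbhd_def)
      then have "p + \<mu> *\<^sub>R v = y" by (auto simp: trop_proj_eq_iff)
      then show ?case using y by simp
    qed
    have ray_finite: "p + \<mu> *\<^sub>R v \<in> finite_part N U" if "\<mu> \<ge> 0" for \<mu>
      using ray[OF that] p vN by (simp add: finite_part_def span_add span_mul)
    have ray_le: "\<phi> (trop_emb (p + \<mu> *\<^sub>R v)) \<le> \<phi> (trop_emb p)" if \<mu>: "\<mu> \<ge> 0" for \<mu>
    proof -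
      have "eventually (\<lambda>\<mu>. (\<phi> \<circ> trop_emb) (p + \<mu> *\<^sub>R v) < ereal M) at_top"
        using evD by eventually_elim (use near in auto)
      from epi_convex_ray_nonincreasing[OF epi ray_finite this \<mu>] show ?thesis by simp
    qed
    obtain \<mu> where \<mu>: "\<mu> \<ge> 0" and pD: "p + \<mu> *\<^sub>R v \<in> D + \<sigma>"
      using eventually_happens[OF eventually_conj[OF evD eventually_ge_at_top[of 0]]] by auto
    define p' where "p' = p + \<mu> *\<^sub>R v"
    have p'N: "p' \<in> span N" using DSN pD by (simp add: p'_def)
    obtain w s where w: "w \<in> D" "s \<in> \<sigma>" "p' = w + s" using pD by (auto simp: p'_def set_plus_def)
    \<comment> \<open>near \<open>q\<close>, \<open>\<phi>\<close> is bounded by \<open>M\<close> on all rays in directions of \<open>\<sigma>\<close>\<close>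
    have cone_le: "\<phi> (trop_emb (y + t)) \<le> \<phi> (trop_emb y)" if y: "y \<in> D + \<sigma>" and t: "t \<in> \<sigma>" for y t
    proof -
      have in_D: "y + \<nu> *\<^sub>R t \<in> D + \<sigma>" if "\<nu> \<ge> 0" for \<nu>
        using plus_cone_closed[OF c\<sigma>(1) y t that] .
      have bound: "eventually (\<lambda>\<nu>. (\<phi> \<circ> trop_emb) (y + \<nu> *\<^sub>R t) < ereal M) at_top"
        using eventually_ge_at_top[of 0] by eventually_elim (use in_D near in auto)
      have "y + \<nu> *\<^sub>R t \<in> finite_part N U" if "\<nu> \<ge> 0" for \<nu>
        using in_D[OF that] near DSN by (simp add: finite_part_def)
      from epi_convex_ray_nonincreasing[OF epi this bound, of 1] show ?thesis by simp
    qed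
    show ?thesis
    proof (rule ccontr)
      assume "\<not> \<phi> q \<le> \<phi> (trop_emb p)"
      then obtain r where r: "\<phi> (trop_emb p) < ereal r" "ereal r < \<phi> q"
        using ereal_dense2 by (metis not_le)
      have less: "\<phi> (trop_emb p') < ereal r"
        using ray_le[OF \<mu>] r(1) unfolding p'_def by (rule le_less_trans)
      obtain d where d: "d > 0"
        "\<And>y. y \<in> ball p' d \<inter> span N \<Longrightarrow> y \<in> finite_part N U \<and> \<phi> (trop_emb y) < ereal r"
        using finite_part_convex_less_open[OF fan U fin conv ray_finite[OF \<mu>, folded p'_def] less] by blast
      \<comment> \<open>small enough for the ball around \<open>p' = w + s\<close> to lie in \<open>D + \<sigma>\<close>, where \<open>\<phi>\<close> decreases along \<open>\<sigma>\<close>\<close>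
      define d' where "d' = min d (e - dist x' w)"
      have d': "d' > 0" using d(1) w(1) by (simp add: d'_def D_def)
      have ball_D: "y \<in> D + \<sigma>" if y: "y \<in> ball p' d' \<inter> span N" for y
      proof -
        have "dist x' (w + (y - p')) \<le> dist x' w + dist w (w + (y - p'))" by (rule dist_triangle)
        also have "dist w (w + (y - p')) = dist p' y" by (simp add: dist_norm norm_minus_commute)
        finally have "dist x' (w + (y - p')) < e" using y by (simp add: d'_def)
        then have "w + (y - p') \<in> D"
          using y p'N w(1) by (simp add: D_def span_add span_diff)
        moreover have "y = w + (y - p') + s" by (simp add: w(3))
        ultimately show ?thesis using w(2) set_plus_intro by metis
      qed
      have "eventually (\<lambda>y. y \<in> U \<inter> trop_emb ` span N \<longrightarrow> \<phi> y \<le> ereal r)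
          (nhdsin (trop_toric N \<Sigma>) (trop_proj \<sigma> p'))"
      proof (rule eventually_nhdsin_trop_toricI[OF fan \<sigma> p'N d'], rule impI)
        fix \<tau> y assume y: "y \<in> ball p' d' \<inter> span N + \<sigma>"
          and \<tau>: "trop_proj \<tau> y \<in> U \<inter> trop_emb ` span N"
        then obtain u t where u: "u \<in> ball p' d' \<inter> span N" "t \<in> \<sigma>" "y = u + t"
          by (auto simp: set_plus_def)
        have "\<phi> (trop_emb y) \<le> \<phi> (trop_emb u)"
          using cone_le[OF ball_D[OF u(1)] u(2)] by (simp add: u(3))
        also have "\<dots> \<le> ereal r" using d(2)[of u] u(1) by (simp add: d'_def less_imp_le)
        finally show "\<phi> (trop_proj \<tau> y) \<le> ereal r"
          using finite_stratum_imp_zero_cone[of \<tau> y N] \<tau> by simp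
      qed
      then have "limsup_within (trop_toric N \<Sigma>) q (U \<inter> trop_emb ` span N) \<phi> \<le> ereal r"
        unfolding q[of \<mu>] p'_def[symmetric]
        by (simp add: limsup_within_def Limsup_bounded eventually_inf_principal)
      then have "\<phi> q \<le> ereal r" using lims[of q] qU False by simp
      then show False using r(2) by simp
    qed
  qed
qed

theorem theorem3p1p4:
  fixes N :: "'a::euclidean_space set"
    and \<Sigma> :: "'a set set"
    and U :: "('a set \<times> 'a set) set"
    and \<phi> :: "'a set \<times> 'a set \<Rightarrow> ereal"
  assumes "is_lattice N"
    and "is_fan N \<Sigma>"
    and "openin (trop_toric N \<Sigma>) U"
    and "\<phi> \<in> U \<rightarrow> {..<\<infinity>}"
  shows "(psh N \<Sigma> U \<phi> \<longleftrightarrow>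
            continuous_map (subtopology (trop_toric N \<Sigma>) U) (top_of_set {..<\<infinity>}) \<phi> \<and>
            convex_on_finite_part N U \<phi>) \<and>
         (psh N \<Sigma> U \<phi> \<longleftrightarrow>
            strongly_usc N \<Sigma> U \<phi> \<and> convex_on_finite_part N U \<phi>) \<and>
         (psh N \<Sigma> U \<phi> \<longleftrightarrow>
            convex_on_finite_part N U \<phi> \<and>
            (\<forall>x \<in> U - trop_emb ` span N.
               \<phi> x = limsup_within (trop_toric N \<Sigma>) x (U \<inter> trop_emb ` span N) \<phi>))"
proof -
  let ?cont = "continuous_map (subtopology (trop_toric N \<Sigma>) U) (top_of_set {..<\<infinity>}) \<phi>"
  let ?conv = "convex_on_finite_part N U \<phi>"
  let ?lims = "\<forall>x \<in> U - trop_emb ` span N.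
    \<phi> x = limsup_within (trop_toric N \<Sigma>) x (U \<inter> trop_emb ` span N) \<phi>"
  have "psh N \<Sigma> U \<phi> \<Longrightarrow> ?cont" "psh N \<Sigma> U \<phi> \<Longrightarrow> ?conv"
    using psh_imp_continuous_at[OF assms(2-4)] continuous_map_ereal_iff_nhdsin[OF assms(3,4)]
    by (auto simp: psh_def)
  moreover have "?cont \<Longrightarrow> strongly_usc N \<Sigma> U \<phi>"
    using continuous_imp_strongly_usc[OF assms(1-3)] continuous_map_ereal_iff_nhdsin[OF assms(3,4)]
    by blast
  moreover have "strongly_usc N \<Sigma> U \<phi> \<Longrightarrow> ?lims"
    using strongly_usc_imp_limsup_over_finite_part by blast
  moreover have "?conv \<Longrightarrow> ?lims \<Longrightarrow> psh N \<Sigma> U \<phi>"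
    using limsup_finite_part_imp_psh[OF assms(2-4)] by blast
  ultimately show ?thesis by argo
qed

end
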